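(* Let $r\ge 0$. Then $-\varphi_1$ is a critical point of $\tilde E_r$ such that (i) $-\varphi_1$ is a strict local minimum of $\tilde E_r$ on $\mathcal{P}$ (with respect to the norm of $\mathbb{H}(\Omega)$), and (ii) $\tilde E_r(-\varphi_1)=\lambda_1^L$. Thus $(\lambda_1^L+r,\lambda_1^L)\in\Sigma_L$, a point lying on the horizontal line through $(\lambda_1^L,\lambda_1^L)$.
   Context: Let $N\ge 1$ be an integer and let $\Omega\subset\mathbb{R}^N$ be a bounded domain (open and connected) with $C^{1,1}$ boundary. $\|\cdot\|_2$ is the $L^2(\Omega)$ norm; $u^\pm=\max\{\pm u,0\}$, so $u=u^+-u^-$. Put $c_N=\pi^{-N/2}\Gamma(N/2)$ and $\rho_N=2\ln 2+\psi(N/2)-\gamma$, with $\psi=\Gamma'/\Gamma$ the digamma function and $\gamma=-\Gamma'(1)$; $B_1$ is the unit ball centred at $0$, $k(z)=\mathbf 1_{B_1}(z)|z|^{-N}$, $j(z)=\mathbf 1_{\mathbb{R}^N\setminus B_1}(z)|z|^{-N}$ for $z\neq 0$. $\mathbb{H}(\Omega)$ is the Hilbert space of all $u\in L^2(\Omega)$, extended by $u=0$ in $\mathbb{R}^N\setminus\Omega$, with $\iint_{\mathbb{R}^{2N}}|u(x)-u(y)|^2k(x-y)\,dx\,dy<\infty$, with inner product $\mathcal{E}(u,v)=\frac{c_N}{2}\iint_{\mathbb{R}^{2N}}(u(x)-u(y))(v(x)-v(y))k(x-y)\,dx\,dy$ and norm $\|u\|=\mathcal{E}(u,u)^{1/2}$.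 The quadratic form of the logarithmic Laplacian $L_\Delta$ (the operator with Fourier symbol $2\ln|\xi|$) is $$\mathcal{E}_L(u,v)=\mathcal{E}(u,v)-c_N\iint_{\mathbb{R}^{2N}}u(x)v(y)j(x-y)\,dx\,dy+\rho_N\int_{\mathbb{R}^N}uv\,dx .$$ The Fučík spectrum $\Sigma_L$ is the set of $(\alpha,\beta)\in\mathbb{R}^2$ for which there is a nontrivial $u\in\mathbb{H}(\Omega)$ with $\mathcal{E}_L(u,v)=\int_\Omega(\alpha u^+-\beta u^-)v\,dx$ for all $v\in\mathbb{H}(\Omega)$ (i.e. a nontrivial weak solution of $L_\Delta u=\alpha u^+-\beta u^-$ in $\Omega$, $u=0$ in $\mathbb{R}^N\setminus\Omega$). The first eigenvalue is $\lambda_1^L=\min\{\mathcal{E}_L(u,u):u\in\mathbb{H}(\Omega),\|u\|_2=1\}$; it is simple, and $\varphi_1>0$ denotes the associated eigenfunction with $\|\varphi_1\|_2=1$. Let $\mathcal{P}=\{u\in\mathbb{H}(\Omega): I(u)=1\}$, $I(u)=\int_\Omega u^2\,dx$, $E_r(u)=\mathcal{E}_L(u,u)-r\int_\Omega(u^+)^2\,dx$, and $\tilde E_r=E_r|_{\mathcal{P}}$. A point $u\in\mathcal{P}$ is a critical point of $\tilde E_r$ if there is $t\in\mathbb{R}$ with $E_r'(u)=tI'(u)$, i.e. $\mathcal{E}_L(u,v)-r\int_\Omega u^+v\,dx=t\int_\Omega uv\,dx$ for all $v\in\mathbb{H}(\Omega)$. *)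

theory Defs
  imports "HOL-Analysis.Analysis"
begin

text \<open>
  The ambient space is an arbitrary Euclidean space \<open>'a\<close>, so \<open>N = DIM('a)\<close>.
  Elements of \<open>L\<^sup>2(\<Omega>)\<close> and of \<open>\<bbbH>(\<Omega>)\<close> are represented by Borel functions on
  the whole space that vanish outside \<open>\<Omega>\<close>; equality of elements is equality almost everywhere.
\<close>

definition c_const :: "nat \<Rightarrow> real" where
  "c_const N = pi powr (- real N / 2) * Gamma (real N / 2)"

definition rho_const :: "nat \<Rightarrow> real" where
  "rho_const N = 2 * ln 2 + Digamma (real N / 2) - euler_mascheroni"

definition k_ker :: "'a::euclidean_space \<Rightarrow> real" where
  "k_ker z = indicator (ball 0 1) z / norm z ^ DIM('a)"

definition j_ker :: "'a::euclidean_space \<Rightarrow> real" where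
  "j_ker z = indicator (- ball 0 1) z / norm z ^ DIM('a)"

definition C11_function :: "('a::euclidean_space \<Rightarrow> real) \<Rightarrow> bool" where
  "C11_function g \<longleftrightarrow>
     (\<exists>G L. (\<forall>x. GDERIV g x :> G x) \<and> L-lipschitz_on UNIV G)"

text \<open>
  Near each boundary point, after a rigid motion, \<open>\<Omega>\<close> is the strict epigraph of a
  \<open>C\<^sup>1\<^sup>,\<^sup>1\<close> function of \<open>N - 1\<close> variables. The unit vector \<open>e\<close> is the vertical direction, and
  \<open>g\<close> is a function on the hyperplane orthogonal to \<open>e\<close>, extended constantly along \<open>e\<close>. For
  \<open>N = 1\<close> this makes \<open>g\<close> a constant. It is no restriction to take \<open>g\<close> globally defined, since a
  local \<open>g\<close> can be cut off away from the boundary point.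
\<close>
definition C11_boundary :: "'a::euclidean_space set \<Rightarrow> bool" where
  "C11_boundary \<Omega> \<longleftrightarrow>
     (\<forall>p\<in>frontier \<Omega>. \<exists>e d g. norm e = 1 \<and> d > 0 \<and> C11_function g \<and>
        (\<forall>x t. g (x + t *\<^sub>R e) = g x) \<and>
        \<Omega> \<inter> ball p d = {x \<in> ball p d. g x < x \<bullet> e})"

definition C11_bounded_domain :: "'a::euclidean_space set \<Rightarrow> bool" where
  "C11_bounded_domain \<Omega> \<longleftrightarrow>
     \<Omega> \<noteq> {} \<and> open \<Omega> \<and> connected \<Omega> \<and> bounded \<Omega> \<and> C11_boundary \<Omega>"

definition pos_part :: "('a \<Rightarrow> real) \<Rightarrow> 'a \<Rightarrow> real" where
  "pos_part u x = max (u x) 0"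

definition neg_part :: "('a \<Rightarrow> real) \<Rightarrow> 'a \<Rightarrow> real" where
  "neg_part u x = max (- u x) 0"

definition L2_space :: "'a::euclidean_space set \<Rightarrow> ('a \<Rightarrow> real) set" where
  "L2_space \<Omega> = {u. u \<in> borel_measurable borel \<and> (\<forall>x. x \<notin> \<Omega> \<longrightarrow> u x = 0) \<and>
                    set_integrable lborel \<Omega> (\<lambda>x. (u x)\<^sup>2)}"

definition L2_norm_on :: "'a::euclidean_space set \<Rightarrow> ('a \<Rightarrow> real) \<Rightarrow> real" where
  "L2_norm_on \<Omega> u = sqrt (LINT x:\<Omega>|lborel. (u x)\<^sup>2)"

definition H_space :: "'a::euclidean_space set \<Rightarrow> ('a \<Rightarrow> real) set" where
  "H_space \<Omega> = {u \<in> L2_space \<Omega>.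
     integrable (lborel \<Otimes>\<^sub>M lborel) (\<lambda>(x, y). \<bar>u x - u y\<bar>\<^sup>2 * k_ker (x - y))}"

definition E_form :: "('a::euclidean_space \<Rightarrow> real) \<Rightarrow> ('a \<Rightarrow> real) \<Rightarrow> real" where
  "E_form u v = c_const DIM('a) / 2 *
     (LINT (x, y)|(lborel \<Otimes>\<^sub>M lborel). (u x - u y) * (v x - v y) * k_ker (x - y))"

definition H_norm :: "('a::euclidean_space \<Rightarrow> real) \<Rightarrow> real" where
  "H_norm u = sqrt (E_form u u)"

definition EL_form :: "('a::euclidean_space \<Rightarrow> real) \<Rightarrow> ('a \<Rightarrow> real) \<Rightarrow> real" where
  "EL_form u v = E_form u v
     - c_const DIM('a) * (LINT (x, y)|(lborel \<Otimes>\<^sub>M lborel). u x * v y * j_ker (x - y))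
     + rho_const DIM('a) * (LINT x|lborel. u x * v x)"

definition Fucik_spectrum :: "'a::euclidean_space set \<Rightarrow> (real \<times> real) set" where
  "Fucik_spectrum \<Omega> = {(\<alpha>, \<beta>). \<exists>u\<in>H_space \<Omega>. \<not> (AE x in lborel. u x = 0) \<and>
     (\<forall>v\<in>H_space \<Omega>.
        EL_form u v = (LINT x:\<Omega>|lborel. (\<alpha> * pos_part u x - \<beta> * neg_part u x) * v x))}"

text \<open>
  The infimum is attained as soon as an eigenfunction for it exists, so for a \<open>\<phi>\<close> with
  \<open>first_eigenfunction \<Omega> \<phi>\<close> below it is the minimum.
\<close>
definition lambda1 :: "'a::euclidean_space set \<Rightarrow> real" where
  "lambda1 \<Omega> = Inf {EL_form u u | u. u \<in> H_space \<Omega> \<and> L2_norm_on \<Omega> u = 1}"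

definition first_eigenfunction :: "'a::euclidean_space set \<Rightarrow> ('a \<Rightarrow> real) \<Rightarrow> bool" where
  "first_eigenfunction \<Omega> \<phi> \<longleftrightarrow>
     \<phi> \<in> H_space \<Omega> \<and>
     (\<forall>v\<in>H_space \<Omega>. EL_form \<phi> v = lambda1 \<Omega> * (LINT x:\<Omega>|lborel. \<phi> x * v x)) \<and>
     (AE x in lborel. x \<in> \<Omega> \<longrightarrow> \<phi> x > 0) \<and>
     L2_norm_on \<Omega> \<phi> = 1"

definition I_fun :: "'a::euclidean_space set \<Rightarrow> ('a \<Rightarrow> real) \<Rightarrow> real" where
  "I_fun \<Omega> u = (LINT x:\<Omega>|lborel. (u x)\<^sup>2)"

definition P_manifold :: "'a::euclidean_space set \<Rightarrow> ('a \<Rightarrow> real) set" where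
  "P_manifold \<Omega> = {u \<in> H_space \<Omega>. I_fun \<Omega> u = 1}"

definition E_r :: "'a::euclidean_space set \<Rightarrow> real \<Rightarrow> ('a \<Rightarrow> real) \<Rightarrow> real" where
  "E_r \<Omega> r u = EL_form u u - r * (LINT x:\<Omega>|lborel. (pos_part u x)\<^sup>2)"

text \<open>
  The Lagrange condition \<open>E\<^sub>r'(u) = t I'(u)\<close> in \<open>\<bbbH>(\<Omega>)\<close>, with the common factor 2 cancelled.
\<close>
definition critical_point :: "'a::euclidean_space set \<Rightarrow> real \<Rightarrow> ('a \<Rightarrow> real) \<Rightarrow> bool" where
  "critical_point \<Omega> r u \<longleftrightarrow> u \<in> P_manifold \<Omega> \<and>
     (\<exists>t. \<forall>v\<in>H_space \<Omega>.
        EL_form u v - r * (LINT x:\<Omega>|lborel. pos_part u x * v x)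
          = t * (LINT x:\<Omega>|lborel. u x * v x))"

definition strict_local_min :: "'a::euclidean_space set \<Rightarrow> real \<Rightarrow> ('a \<Rightarrow> real) \<Rightarrow> bool" where
  "strict_local_min \<Omega> r u \<longleftrightarrow> u \<in> P_manifold \<Omega> \<and>
     (\<exists>\<delta>>0. \<forall>w\<in>P_manifold \<Omega>.
        H_norm (\<lambda>x. w x - u x) < \<delta> \<and> \<not> (AE x in lborel. w x = u x) \<longrightarrow>
        E_r \<Omega> r u < E_r \<Omega> r w)"

end

theory Submission
  imports Defs
begin

text \<open>
  Write \<open>\<lambda>\<close> for \<open>lambda1 \<Omega>\<close> and \<open>Q\<close> for the form \<open>EL_form u v - \<lambda> * \<integral> u v\<close>. Since \<open>\<phi>\<close> is nonnegative, the
  positive part of \<open>-\<phi>\<close> vanishes almost everywhere, so the eigenvalue equation of \<open>\<phi>\<close> is at once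
  the Lagrange condition at \<open>-\<phi>\<close> with multiplier \<open>\<lambda>\<close>, the identity for the value of the functional,
  and the weak equation with \<open>(\<alpha>, \<beta>) = (\<lambda> + r, \<lambda>)\<close>. The content is the strict local minimality.

  Let \<open>w\<close> be normalized and split it as \<open>w = p - n\<close> into its positive and negative parts. Both
  kernels act with the same sign on the cross term, so \<open>EL_form p n \<le> 0\<close>
  (\<open>EL_form_disjoint_supports\<close>), and therefore \<open>Q(w,w) \<ge> Q(p,p) + Q(n,n)\<close>, while \<open>Q(n,n) \<ge> 0\<close>.

  If \<open>p \<noteq> 0\<close>, it remains to see that \<open>Q(p,p) > r * \<integral> p\<^sup>2\<close>. This is a matter of the size of the
  support of \<open>p\<close>. The kernel \<open>\<bar>z\<bar>\<^sup>-\<^sup>N\<close> is not integrable at the origin, so a function living on a set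
  of small measure has large energy relative to its \<open>L\<^sup>2\<close> norm (\<open>E_form_ge_small_support\<close>), and the
  other terms of \<open>EL_form\<close> are bounded in \<open>L\<^sup>2\<close> (\<open>EL_form_ge\<close>). The set \<open>{w > 0}\<close> is indeed small when
  \<open>w\<close> is close to \<open>-\<phi>\<close> in \<open>L\<^sup>2\<close> (\<open>small_positivity_set\<close>), and closeness in \<open>L\<^sup>2\<close> follows from closeness
  in the norm of \<open>\<bbbH>(\<Omega>)\<close> by the Poincare inequality (\<open>H_space_Poincare\<close>).

  If \<open>p = 0\<close>, the values to be compared are \<open>EL_form w w\<close> and \<open>\<lambda>\<close>, and equality must force
  \<open>w = -\<phi>\<close>. This is the simplicity of \<open>\<lambda>\<close> (\<open>nonpositive_minimizer_unique\<close>): every function with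
  \<open>Q(u,u) = 0\<close> has constant sign, because otherwise its two parts would interact, and this applies to
  \<open>w + \<phi>\<close>.
\<close>

section \<open>The function spaces and the quadratic forms\<close>

lemma k_ker_nonneg: "0 \<le> k_ker z" and j_ker_nonneg: "0 \<le> j_ker z"
  by (simp_all add: k_ker_def j_ker_def)

lemma j_ker_le_one: "j_ker (z :: 'a::euclidean_space) \<le> 1"
  by (auto simp: j_ker_def indicator_def divide_simps)

lemma k_ker_commute: "k_ker (x - y) = k_ker (y - x)" and j_ker_commute: "j_ker (x - y) = j_ker (y - x)"
  by (auto simp: k_ker_def j_ker_def indicator_def norm_minus_commute)

lemma k_ker_plus_j_ker_pos: "z \<noteq> 0 \<Longrightarrow> 0 < k_ker z + j_ker z"
  by (auto simp: k_ker_def j_ker_def indicator_def)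

lemma k_ker_measurable [measurable]: "k_ker \<in> borel_measurable borel"
  unfolding k_ker_def
  by (intro borel_measurable_divide borel_measurable_power borel_measurable_indicator) auto

lemma j_ker_measurable [measurable]: "j_ker \<in> borel_measurable borel"
  unfolding j_ker_def
  by (intro borel_measurable_divide borel_measurable_power borel_measurable_indicator) auto

lemma c_const_pos: "0 < N \<Longrightarrow> 0 < c_const N"
  by (simp add: c_const_def Gamma_real_pos)

lemma set_integral_eq_integral:
  fixes f :: "'a::euclidean_space \<Rightarrow> real"
  assumes "\<And>x. x \<notin> \<Omega> \<Longrightarrow> f x = 0"
  shows "(LINT x:\<Omega>|lborel. f x) = (LINT x|lborel. f x)"
  unfolding set_lebesgue_integral_def
  by (rule Bochner_Integration.integral_cong) (use assms in \<open>auto simp: indicator_def\<close>)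

lemma H_space_iff:
  "u \<in> H_space \<Omega> \<longleftrightarrow>
     u \<in> borel_measurable borel \<and> (\<forall>x. x \<notin> \<Omega> \<longrightarrow> u x = 0) \<and>
     integrable lborel (\<lambda>x. (u x)\<^sup>2) \<and>
     integrable (lborel \<Otimes>\<^sub>M lborel) (\<lambda>(x, y). (u x - u y)\<^sup>2 * k_ker (x - y))"
proof -
  have "set_integrable lborel \<Omega> (\<lambda>x. (u x)\<^sup>2) \<longleftrightarrow> integrable lborel (\<lambda>x. (u x)\<^sup>2)"
    if "\<forall>x. x \<notin> \<Omega> \<longrightarrow> u x = 0"
    unfolding set_integrable_def
    by (rule Bochner_Integration.integrable_cong) (use that in \<open>auto simp: indicator_def\<close>)
  then show ?thesis
    by (auto simp: H_space_def L2_space_def)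
qed

lemma H_space_measurable: "u \<in> H_space \<Omega> \<Longrightarrow> u \<in> borel_measurable borel"
  and H_space_outside: "u \<in> H_space \<Omega> \<Longrightarrow> x \<notin> \<Omega> \<Longrightarrow> u x = 0"
  and H_space_square_integrable: "u \<in> H_space \<Omega> \<Longrightarrow> integrable lborel (\<lambda>x. (u x)\<^sup>2)"
  and H_space_energy_integrable: "u \<in> H_space \<Omega> \<Longrightarrow>
        integrable (lborel \<Otimes>\<^sub>M lborel) (\<lambda>(x, y). (u x - u y)\<^sup>2 * k_ker (x - y))"
  by (auto simp: H_space_iff)

lemma H_space_set_integral_square:
  "u \<in> H_space \<Omega> \<Longrightarrow> (LINT x:\<Omega>|lborel. (u x)\<^sup>2) = (LINT x|lborel. (u x)\<^sup>2)"
  by (rule set_integral_eq_integral) (simp add: H_space_outside)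

lemma abs_mult_le_sum_squares: "\<bar>a * b\<bar> \<le> a\<^sup>2 + (b::real)\<^sup>2"
proof -
  have "0 \<le> (\<bar>a\<bar> - \<bar>b\<bar>)\<^sup>2" by simp
  then have "2 * \<bar>a * b\<bar> \<le> a\<^sup>2 + b\<^sup>2"
    by (simp add: power2_diff abs_mult)
  moreover have "0 \<le> \<bar>a * b\<bar>" by simp
  ultimately show ?thesis by linarith
qed

lemma H_space_mult_integrable:
  assumes "u \<in> H_space \<Omega>" "v \<in> H_space \<Omega>"
  shows "integrable lborel (\<lambda>x. u x * v x)"
proof (rule Bochner_Integration.integrable_bound)
  note [measurable] = assms[THEN H_space_measurable]
  show "integrable lborel (\<lambda>x. (u x)\<^sup>2 + (v x)\<^sup>2)"
    using assms by (auto intro: H_space_square_integrable)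
  show "(\<lambda>x. u x * v x) \<in> borel_measurable lborel" by measurable
qed (auto simp: abs_mult_le_sum_squares)

lemma H_space_energy_mult_integrable:
  assumes "u \<in> H_space \<Omega>" "v \<in> H_space \<Omega>"
  shows "integrable (lborel \<Otimes>\<^sub>M lborel) (\<lambda>(x, y). (u x - u y) * (v x - v y) * k_ker (x - y))"
proof (rule Bochner_Integration.integrable_bound)
  note [measurable] = assms[THEN H_space_measurable]
  show "integrable (lborel \<Otimes>\<^sub>M lborel)
          (\<lambda>p. (case p of (x, y) \<Rightarrow> (u x - u y)\<^sup>2 * k_ker (x - y)) +
               (case p of (x, y) \<Rightarrow> (v x - v y)\<^sup>2 * k_ker (x - y)))"
    by (intro Bochner_Integration.integrable_add H_space_energy_integrable[of _ \<Omega>] assms)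
  show "(\<lambda>(x, y). (u x - u y) * (v x - v y) * k_ker (x - y))
          \<in> borel_measurable (lborel \<Otimes>\<^sub>M lborel)"
    by measurable
  show "AE p in lborel \<Otimes>\<^sub>M lborel.
      norm (case p of (x, y) \<Rightarrow> (u x - u y) * (v x - v y) * k_ker (x - y))
        \<le> norm ((case p of (x, y) \<Rightarrow> (u x - u y)\<^sup>2 * k_ker (x - y)) +
               (case p of (x, y) \<Rightarrow> (v x - v y)\<^sup>2 * k_ker (x - y)))"
  proof (rule always_eventually, safe)
    fix x y
    have "\<bar>(u x - u y) * (v x - v y)\<bar> * k_ker (x - y)
        \<le> ((u x - u y)\<^sup>2 + (v x - v y)\<^sup>2) * k_ker (x - y)"
      by (intro mult_right_mono abs_mult_le_sum_squares k_ker_nonneg)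
    moreover have "0 \<le> ((u x - u y)\<^sup>2 + (v x - v y)\<^sup>2) * k_ker (x - y)"
      by (intro mult_nonneg_nonneg k_ker_nonneg) auto
    ultimately show "norm ((u x - u y) * (v x - v y) * k_ker (x - y))
        \<le> norm ((u x - u y)\<^sup>2 * k_ker (x - y) + (v x - v y)\<^sup>2 * k_ker (x - y))"
      by (simp add: abs_mult[of _ "k_ker _"] k_ker_nonneg distrib_right)
  qed
qed

lemma integrable_tensor:
  fixes f g :: "'a::euclidean_space \<Rightarrow> real"
  assumes f: "integrable lborel f" and g: "integrable lborel g"
  shows "integrable (lborel \<Otimes>\<^sub>M lborel) (\<lambda>(x, y). f x * g y)"
    and "(LINT (x, y)|(lborel \<Otimes>\<^sub>M lborel). f x * g y) = (LINT x|lborel. f x) * (LINT y|lborel. g y)"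
proof -
  note [measurable] = f[THEN borel_measurable_integrable] g[THEN borel_measurable_integrable]
  show *: "integrable (lborel \<Otimes>\<^sub>M lborel) (\<lambda>(x, y). f x * g y)"
  proof (rule lborel_pair.Fubini_integrable)
    have "integrable lborel (\<lambda>x. \<bar>f x\<bar> * (LINT y|lborel. \<bar>g y\<bar>))"
      using f by auto
    then show "integrable lborel (\<lambda>x. LINT y|lborel. norm (case (x, y) of (x, y) \<Rightarrow> f x * g y))"
      by (simp add: abs_mult)
  qed (use g in \<open>auto\<close>)
  show "(LINT (x, y)|(lborel \<Otimes>\<^sub>M lborel). f x * g y) = (LINT x|lborel. f x) * (LINT y|lborel. g y)"
    using lborel_pair.integral_fst'[OF *] by simp
qed

lemma max_zero_lipschitz: "\<bar>max a 0 - max b 0\<bar> \<le> \<bar>a - (b::real)\<bar>"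
  by auto

text \<open>
  A map that contracts distances and fixes 0 does not increase either of the two integrals that
  define membership in \<open>\<bbbH>(\<Omega>)\<close>.
\<close>
lemma H_space_contraction:
  assumes u: "u \<in> H_space \<Omega>" and T[measurable]: "T \<in> borel_measurable borel"
    and "T 0 = 0" and lip: "\<And>a b. \<bar>T a - T b\<bar> \<le> \<bar>a - (b::real)\<bar>"
  shows "(\<lambda>x. T (u x)) \<in> H_space \<Omega>"
  unfolding H_space_iff
proof (intro conjI allI impI)
  note [measurable] = H_space_measurable[OF u]
  show "(\<lambda>x. T (u x)) \<in> borel_measurable borel" by measurable
  show "T (u x) = 0" if "x \<notin> \<Omega>" for x
    using H_space_outside[OF u that] \<open>T 0 = 0\<close> by simp
  show "integrable lborel (\<lambda>x. (T (u x))\<^sup>2)"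
    by (rule Bochner_Integration.integrable_bound[OF H_space_square_integrable[OF u]])
       (use lip[of _ 0] \<open>T 0 = 0\<close> in \<open>auto simp: abs_le_square_iff[symmetric]\<close>)
  show "integrable (lborel \<Otimes>\<^sub>M lborel) (\<lambda>(x, y). (T (u x) - T (u y))\<^sup>2 * k_ker (x - y))"
  proof (rule Bochner_Integration.integrable_bound[OF H_space_energy_integrable[OF u]])
    show "(\<lambda>(x, y). (T (u x) - T (u y))\<^sup>2 * k_ker (x - y)) \<in> borel_measurable (lborel \<Otimes>\<^sub>M lborel)"
      by measurable
    have "(T a - T b)\<^sup>2 \<le> (a - b)\<^sup>2" for a b
      using lip[of a b] by (simp add: abs_le_square_iff[symmetric])
    then show "AE p in lborel \<Otimes>\<^sub>M lborel.
        norm (case p of (x, y) \<Rightarrow> (T (u x) - T (u y))\<^sup>2 * k_ker (x - y))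
        \<le> norm (case p of (x, y) \<Rightarrow> (u x - u y)\<^sup>2 * k_ker (x - y))"
      by (auto simp: abs_mult k_ker_nonneg intro!: mult_right_mono always_eventually)
  qed
qed

lemma H_space_pos_part: "u \<in> H_space \<Omega> \<Longrightarrow> pos_part u \<in> H_space \<Omega>"
  using H_space_contraction[of u \<Omega> "\<lambda>a. max a 0"] max_zero_lipschitz
  by (simp add: pos_part_def[abs_def])

lemma H_space_uminus: "u \<in> H_space \<Omega> \<Longrightarrow> (\<lambda>x. - u x) \<in> H_space \<Omega>"
  by (rule H_space_contraction[of u \<Omega> uminus]) auto

lemma neg_part_eq_pos_part: "neg_part u = pos_part (\<lambda>x. - u x)"
  by (auto simp: neg_part_def pos_part_def)

lemma H_space_neg_part: "u \<in> H_space \<Omega> \<Longrightarrow> neg_part u \<in> H_space \<Omega>"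
  by (simp add: neg_part_eq_pos_part H_space_pos_part H_space_uminus)

lemma H_space_add:
  assumes u: "u \<in> H_space \<Omega>" and v: "v \<in> H_space \<Omega>"
  shows "(\<lambda>x. u x + v x) \<in> H_space \<Omega>"
  unfolding H_space_iff
proof (intro conjI allI impI)
  note [measurable] = assms[THEN H_space_measurable]
  show "(\<lambda>x. u x + v x) \<in> borel_measurable borel" by measurable
  show "u x + v x = 0" if "x \<notin> \<Omega>" for x
    using assms[THEN H_space_outside[OF _ that]] by simp
  have "integrable lborel (\<lambda>x. (u x)\<^sup>2 + 2 * (u x * v x) + (v x)\<^sup>2)"
    using assms
    by (intro Bochner_Integration.integrable_add integrable_mult_right H_space_mult_integrable
          H_space_square_integrable) auto
  then show "integrable lborel (\<lambda>x. (u x + v x)\<^sup>2)"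
    by (simp add: power2_sum ac_simps)
  have "integrable (lborel \<Otimes>\<^sub>M lborel)
      (\<lambda>p. (case p of (x, y) \<Rightarrow> (u x - u y)\<^sup>2 * k_ker (x - y)) +
           2 * (case p of (x, y) \<Rightarrow> (u x - u y) * (v x - v y) * k_ker (x - y)) +
           (case p of (x, y) \<Rightarrow> (v x - v y)\<^sup>2 * k_ker (x - y)))"
    using assms
    by (intro Bochner_Integration.integrable_add integrable_mult_right H_space_energy_integrable
          H_space_energy_mult_integrable) auto
  then show "integrable (lborel \<Otimes>\<^sub>M lborel) (\<lambda>(x, y). ((u x + v x) - (u y + v y))\<^sup>2 * k_ker (x - y))"
    by (rule Bochner_Integration.integrable_cong[THEN iffD1, rotated 2])
       (auto simp: power2_eq_square algebra_simps)
qed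

lemma H_space_scale:
  assumes u: "u \<in> H_space \<Omega>"
  shows "(\<lambda>x. a * u x) \<in> H_space \<Omega>"
  unfolding H_space_iff
proof (intro conjI allI impI)
  note [measurable] = H_space_measurable[OF u]
  show "(\<lambda>x. a * u x) \<in> borel_measurable borel" by measurable
  show "a * u x = 0" if "x \<notin> \<Omega>" for x
    using H_space_outside[OF u that] by simp
  show "integrable lborel (\<lambda>x. (a * u x)\<^sup>2)"
    using H_space_square_integrable[OF u] by (simp add: power_mult_distrib)
  have "integrable (lborel \<Otimes>\<^sub>M lborel) (\<lambda>p. a\<^sup>2 * (case p of (x, y) \<Rightarrow> (u x - u y)\<^sup>2 * k_ker (x - y)))"
    by (intro integrable_mult_right H_space_energy_integrable[OF u])
  then show "integrable (lborel \<Otimes>\<^sub>M lborel) (\<lambda>(x, y). (a * u x - a * u y)\<^sup>2 * k_ker (x - y))"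
    by (rule Bochner_Integration.integrable_cong[THEN iffD1, rotated 2])
       (auto simp: power2_eq_square algebra_simps)
qed

lemma E_form_add_left:
  assumes "u \<in> H_space \<Omega>" "v \<in> H_space \<Omega>" "w \<in> H_space \<Omega>"
  shows "E_form (\<lambda>x. u x + v x) w = E_form u w + E_form v w"
proof -
  have "(LINT (x, y)|(lborel \<Otimes>\<^sub>M lborel). ((u x + v x) - (u y + v y)) * (w x - w y) * k_ker (x - y))
      = (LINT p|(lborel \<Otimes>\<^sub>M lborel).
           (case p of (x, y) \<Rightarrow> (u x - u y) * (w x - w y) * k_ker (x - y)) +
           (case p of (x, y) \<Rightarrow> (v x - v y) * (w x - w y) * k_ker (x - y)))"
    by (rule Bochner_Integration.integral_cong) (auto simp: algebra_simps)
  also have "\<dots> = (LINT (x, y)|(lborel \<Otimes>\<^sub>M lborel). (u x - u y) * (w x - w y) * k_ker (x - y))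
      + (LINT (x, y)|(lborel \<Otimes>\<^sub>M lborel). (v x - v y) * (w x - w y) * k_ker (x - y))"
    using assms by (intro Bochner_Integration.integral_add H_space_energy_mult_integrable)
  finally show ?thesis
    by (simp add: E_form_def distrib_left)
qed

lemma E_form_commute: "E_form u v = E_form v u"
  by (simp add: E_form_def ac_simps)

lemma E_form_scale_left: "E_form (\<lambda>x. a * u x) v = a * E_form u v"
proof -
  have "(LINT (x, y)|(lborel \<Otimes>\<^sub>M lborel). (a * u x - a * u y) * (v x - v y) * k_ker (x - y))
      = (LINT p|(lborel \<Otimes>\<^sub>M lborel). a * (case p of (x, y) \<Rightarrow> (u x - u y) * (v x - v y) * k_ker (x - y)))"
    by (rule Bochner_Integration.integral_cong) (auto simp: algebra_simps)
  then show ?thesis by (simp add: E_form_def)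
qed

definition J_form :: "('a::euclidean_space \<Rightarrow> real) \<Rightarrow> ('a \<Rightarrow> real) \<Rightarrow> real" where
  "J_form u v = (LINT (x, y)|(lborel \<Otimes>\<^sub>M lborel). u x * v y * j_ker (x - y))"

lemma J_form_scale_left: "J_form (\<lambda>x. a * u x) v = a * J_form u v"
proof -
  have "J_form (\<lambda>x. a * u x) v
      = (LINT p|(lborel \<Otimes>\<^sub>M lborel). a * (case p of (x, y) \<Rightarrow> u x * v y * j_ker (x - y)))"
    unfolding J_form_def by (rule Bochner_Integration.integral_cong) (auto simp: algebra_simps)
  then show ?thesis by (simp add: J_form_def)
qed

lemma J_form_commute:
  assumes [measurable]: "u \<in> borel_measurable borel" "v \<in> borel_measurable borel"
  shows "J_form u v = J_form v u"
proof -
  have "J_form u v = (LINT (x, y)|(lborel \<Otimes>\<^sub>M lborel). u y * v x * j_ker (y - x))"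
    unfolding J_form_def
    by (subst lborel_pair.integral_product_swap[symmetric]) auto
  also have "\<dots> = J_form v u"
    unfolding J_form_def
    by (rule Bochner_Integration.integral_cong) (auto simp: j_ker_commute mult.commute[of "u _"])
  finally show ?thesis .
qed

text \<open>
  On a bounded set the kernel \<open>j\<close> is a bounded perturbation of the \<open>L\<^sup>2\<close> inner product, because it is
  bounded by 1 and \<open>\<bar>u x * v y\<bar>\<close> is bounded by the integrable function
  \<open>(u x)\<^sup>2 * indicator \<Omega> y + indicator \<Omega> x * (v y)\<^sup>2\<close>.
\<close>
lemma J_form_bound:
  assumes \<Omega>: "open \<Omega>" "bounded \<Omega>" and u: "u \<in> H_space \<Omega>" and v: "v \<in> H_space \<Omega>"
  shows "integrable (lborel \<Otimes>\<^sub>M lborel) (\<lambda>(x, y). u x * v y * j_ker (x - y))"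
    and "\<bar>J_form u v\<bar> \<le> measure lborel \<Omega> * ((LINT x|lborel. (u x)\<^sup>2) + (LINT x|lborel. (v x)\<^sup>2))"
proof -
  note [measurable] = u[THEN H_space_measurable] v[THEN H_space_measurable]
  have [measurable]: "\<Omega> \<in> sets borel" using \<Omega> by simp
  have ind: "integrable lborel (indicator \<Omega> :: 'a \<Rightarrow> real)"
    using emeasure_bounded_finite[OF \<Omega>(2)] by (auto simp: integrable_indicator_iff)
  define B where "B = (\<lambda>p. (case p of (x, y) \<Rightarrow> (u x)\<^sup>2 * indicator \<Omega> y) +
                           (case p of (x, y) \<Rightarrow> indicator \<Omega> x * (v y)\<^sup>2))"
  note tensor = integrable_tensor[OF H_space_square_integrable[OF u] ind]
                integrable_tensor[OF ind H_space_square_integrable[OF v]]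
  have B: "integrable (lborel \<Otimes>\<^sub>M lborel) B"
    unfolding B_def using tensor by (intro Bochner_Integration.integrable_add) auto
  have B_integral: "(LINT p|(lborel \<Otimes>\<^sub>M lborel). B p)
      = measure lborel \<Omega> * ((LINT x|lborel. (u x)\<^sup>2) + (LINT x|lborel. (v x)\<^sup>2))"
    unfolding B_def using tensor by (simp add: algebra_simps)
  have pointwise: "\<bar>u x * v y * j_ker (x - y)\<bar> \<le> B (x, y)" for x y
  proof (cases "x \<in> \<Omega> \<and> y \<in> \<Omega>")
    case True
    have "\<bar>u x * v y * j_ker (x - y)\<bar> \<le> \<bar>u x * v y\<bar>"
      by (simp add: abs_mult[of _ "j_ker _"] j_ker_nonneg j_ker_le_one mult_left_le)
    then show ?thesis
      using abs_mult_le_sum_squares[of "u x" "v y"] True by (simp add: B_def)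
  next
    case False
    then show ?thesis
      using H_space_outside[OF u] H_space_outside[OF v] by (auto simp: B_def)
  qed
  show int: "integrable (lborel \<Otimes>\<^sub>M lborel) (\<lambda>(x, y). u x * v y * j_ker (x - y))"
  proof (rule Bochner_Integration.integrable_bound[OF B])
    show "AE p in lborel \<Otimes>\<^sub>M lborel.
        norm (case p of (x, y) \<Rightarrow> u x * v y * j_ker (x - y)) \<le> norm (B p)"
      using pointwise by (auto intro!: always_eventually order_trans[OF _ abs_ge_self])
  qed measurable
  have "\<bar>J_form u v\<bar> \<le> (LINT p|(lborel \<Otimes>\<^sub>M lborel). \<bar>case p of (x, y) \<Rightarrow> u x * v y * j_ker (x - y)\<bar>)"
    unfolding J_form_def by (rule integral_abs_bound)
  also have "\<dots> \<le> (LINT p|(lborel \<Otimes>\<^sub>M lborel). B p)"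
    using pointwise by (intro integral_mono B integrable_abs int) auto
  finally show "\<bar>J_form u v\<bar>
      \<le> measure lborel \<Omega> * ((LINT x|lborel. (u x)\<^sup>2) + (LINT x|lborel. (v x)\<^sup>2))"
    by (simp add: B_integral)
qed

lemma J_form_add_left:
  assumes "open \<Omega>" "bounded \<Omega>" "u \<in> H_space \<Omega>" "v \<in> H_space \<Omega>" "w \<in> H_space \<Omega>"
  shows "J_form (\<lambda>x. u x + v x) w = J_form u w + J_form v w"
proof -
  have "J_form (\<lambda>x. u x + v x) w
      = (LINT p|(lborel \<Otimes>\<^sub>M lborel).
           (case p of (x, y) \<Rightarrow> u x * w y * j_ker (x - y)) +
           (case p of (x, y) \<Rightarrow> v x * w y * j_ker (x - y)))"
    unfolding J_form_def by (rule Bochner_Integration.integral_cong) (auto simp: algebra_simps)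
  also have "\<dots> = J_form u w + J_form v w"
    unfolding J_form_def using assms by (intro Bochner_Integration.integral_add J_form_bound(1)) auto
  finally show ?thesis .
qed

lemma EL_form_eq:
  "EL_form u v = E_form u v - c_const DIM('a) * J_form u v
     + rho_const DIM('a) * (LINT x|lborel. u x * v x)"
  for u v :: "'a::euclidean_space \<Rightarrow> real"
  by (simp add: EL_form_def J_form_def)

lemma EL_form_scale_left: "EL_form (\<lambda>x. a * u x) v = a * EL_form u v"
  by (simp add: EL_form_eq E_form_scale_left J_form_scale_left mult.assoc) (simp add: algebra_simps)

lemma EL_form_uminus_left: "EL_form (\<lambda>x. - u x) v = - EL_form u v"
  using EL_form_scale_left[of "-1" u v] by simp

lemma EL_form_commute:
  assumes "u \<in> H_space \<Omega>" "v \<in> H_space \<Omega>"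
  shows "EL_form u v = EL_form v u"
  using J_form_commute[OF assms[THEN H_space_measurable]]
  by (simp add: EL_form_eq E_form_commute[of u v] mult.commute[of "u _"])

lemma EL_form_add_left:
  assumes "open \<Omega>" "bounded \<Omega>" "u \<in> H_space \<Omega>" "v \<in> H_space \<Omega>" "w \<in> H_space \<Omega>"
  shows "EL_form (\<lambda>x. u x + v x) w = EL_form u w + EL_form v w"
proof -
  have "(LINT x|lborel. (u x + v x) * w x) = (LINT x|lborel. u x * w x) + (LINT x|lborel. v x * w x)"
    using assms by (simp add: distrib_right H_space_mult_integrable)
  then show ?thesis
    using assms
    by (simp add: EL_form_eq E_form_add_left[of _ \<Omega>] J_form_add_left[of \<Omega>] algebra_simps)
qed

lemma E_form_nonneg: "0 \<le> E_form u u" for u :: "'a::euclidean_space \<Rightarrow> real"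
  unfolding E_form_def
  using c_const_pos[OF DIM_positive[where 'a='a]]
  by (intro mult_nonneg_nonneg Bochner_Integration.integral_nonneg) (auto simp: k_ker_nonneg)

lemma EL_form_ge:
  fixes u :: "'a::euclidean_space \<Rightarrow> real"
  assumes "open \<Omega>" "bounded \<Omega>" "u \<in> H_space \<Omega>"
  shows "E_form u u + (rho_const DIM('a) - 2 * c_const DIM('a) * measure lborel \<Omega>)
             * (LINT x|lborel. (u x)\<^sup>2) \<le> EL_form u u"
proof -
  have "J_form u u \<le> measure lborel \<Omega> * (2 * (LINT x|lborel. (u x)\<^sup>2))"
    using J_form_bound(2)[OF assms(1,2,3,3)] by simp
  from mult_left_mono[OF this less_imp_le[OF c_const_pos[OF DIM_positive[where 'a='a]]]]
  show ?thesis
    by (simp add: EL_form_eq power2_eq_square algebra_simps)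
qed

section \<open>The first eigenvalue and the sign of its eigenfunctions\<close>

lemma lambda1_le:
  fixes u :: "'a::euclidean_space \<Rightarrow> real"
  assumes \<Omega>: "open \<Omega>" "bounded \<Omega>" and u: "u \<in> H_space \<Omega>"
  shows "lambda1 \<Omega> * (LINT x|lborel. (u x)\<^sup>2) \<le> EL_form u u"
proof (cases "(LINT x|lborel. (u x)\<^sup>2) = 0")
  case True
  then show ?thesis
    using EL_form_ge[OF \<Omega> u] E_form_nonneg[of u] by simp
next
  case False
  define S where "S = (LINT x|lborel. (u x)\<^sup>2)"
  define v where "v = (\<lambda>x. 1 / sqrt S * u x)"
  have S: "0 < S"
    using False by (simp add: S_def order_less_le)
  have v: "v \<in> H_space \<Omega>"
    unfolding v_def by (rule H_space_scale[OF u])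
  have "(LINT x|lborel. (v x)\<^sup>2) = (1 / sqrt S)\<^sup>2 * S"
    by (simp add: v_def power_divide S_def)
  then have "(LINT x|lborel. (v x)\<^sup>2) = 1"
    using S by (simp add: power_divide)
  then have "L2_norm_on \<Omega> v = 1"
    using v by (simp add: L2_norm_on_def H_space_set_integral_square)
  then have mem: "EL_form v v \<in> {EL_form u u | u. u \<in> H_space \<Omega> \<and> L2_norm_on \<Omega> u = 1}"
    using v by blast
  have "bdd_below {EL_form u u | u. u \<in> H_space \<Omega> \<and> L2_norm_on \<Omega> u = 1}"
  proof (rule bdd_belowI, clarify)
    fix w :: "'a \<Rightarrow> real" assume w: "w \<in> H_space \<Omega>" and "L2_norm_on \<Omega> w = 1"
    then have "(LINT x|lborel. (w x)\<^sup>2) = 1"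
      by (simp add: L2_norm_on_def H_space_set_integral_square)
    then show "rho_const DIM('a) - 2 * c_const DIM('a) * measure lborel \<Omega> \<le> EL_form w w"
      using EL_form_ge[OF \<Omega> w] E_form_nonneg[of w] by simp
  qed
  from cInf_lower[OF mem this] have "lambda1 \<Omega> \<le> EL_form v v"
    by (simp add: lambda1_def)
  also have "EL_form v v = (1 / sqrt S) * ((1 / sqrt S) * EL_form u u)"
    using EL_form_scale_left[of "1 / sqrt S" u] EL_form_commute[OF u v] unfolding v_def by metis
  also have "\<dots> = EL_form u u / S"
    using S by simp
  finally show ?thesis
    using S by (simp add: S_def field_simps)
qed

text \<open>
  Only the cross terms of the double integrals survive when the supports are disjoint, and the two
  kernels then enter with the same sign. Off the diagonal \<open>k + j\<close> is strictly positive, so by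
  nonlocality the interaction can vanish only if one of the two functions does.
\<close>
lemma EL_form_disjoint_supports:
  fixes p n :: "'a::euclidean_space \<Rightarrow> real"
  assumes \<Omega>: "open \<Omega>" "bounded \<Omega>" and p: "p \<in> H_space \<Omega>" and n: "n \<in> H_space \<Omega>"
    and nonneg: "\<And>x. 0 \<le> p x" "\<And>x. 0 \<le> n x" and disj: "\<And>x. p x * n x = 0"
  shows "EL_form p n \<le> 0"
    and "EL_form p n = 0 \<Longrightarrow> (AE x in lborel. p x = 0) \<or> (AE x in lborel. n x = 0)"
proof -
  note [measurable] = p[THEN H_space_measurable] n[THEN H_space_measurable]
  (* EL_form p n is - c times the integral of F, the term with rho vanishing because p * n = 0. *)
  define F where "F = (\<lambda>q. - 1 / 2 * (case q of (x, y) \<Rightarrow> (p x - p y) * (n x - n y) * k_ker (x - y))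
                        + (case q of (x, y) \<Rightarrow> p x * n y * j_ker (x - y)))"
  have c: "0 < c_const DIM('a)"
    by (rule c_const_pos[OF DIM_positive])
  have F_int: "integrable (lborel \<Otimes>\<^sub>M lborel) F"
    unfolding F_def
    by (intro Bochner_Integration.integrable_add integrable_mult_right J_form_bound(1)[OF \<Omega>]
          H_space_energy_mult_integrable[of _ \<Omega>] p n)
  have "(LINT q|(lborel \<Otimes>\<^sub>M lborel). F q) =
      - 1 / 2 * (LINT (x, y)|(lborel \<Otimes>\<^sub>M lborel). (p x - p y) * (n x - n y) * k_ker (x - y)) + J_form p n"
    unfolding F_def J_form_def
    by (subst Bochner_Integration.integral_add)
       (auto intro!: integrable_mult_right J_form_bound(1)[OF \<Omega>]
          H_space_energy_mult_integrable[of _ \<Omega>] p n)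
  then have EL: "EL_form p n = - c_const DIM('a) * (LINT q|(lborel \<Otimes>\<^sub>M lborel). F q)"
    by (simp add: EL_form_eq E_form_def disj right_diff_distrib)
  have F_ge: "p x * n y * (k_ker (x - y) / 2 + j_ker (x - y)) \<le> F (x, y)" for x y
  proof -
    have "(p x - p y) * (n x - n y) = p x * n x - p x * n y - p y * n x + p y * n y"
      by (simp add: algebra_simps)
    then have cross: "(p x - p y) * (n x - n y) = - (p x * n y) - p y * n x"
      by (simp add: disj del: mult_eq_0_iff)
    have "F (x, y) = p x * n y * (k_ker (x - y) / 2 + j_ker (x - y)) + p y * n x * k_ker (x - y) / 2"
      unfolding F_def prod.case cross by (simp add: field_simps)
    moreover have "0 \<le> p y * n x * k_ker (x - y)"
      by (intro mult_nonneg_nonneg nonneg k_ker_nonneg)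
    ultimately show ?thesis by simp
  qed
  have F_nonneg: "0 \<le> F q" for q
  proof (cases q)
    case (Pair x y)
    have "0 \<le> p x * n y * (k_ker (x - y) / 2 + j_ker (x - y))"
      by (intro mult_nonneg_nonneg nonneg add_nonneg_nonneg) (auto simp: k_ker_nonneg j_ker_nonneg)
    then show ?thesis using F_ge[of x y] Pair by simp
  qed
  show "EL_form p n \<le> 0"
    unfolding EL using c F_nonneg by (simp add: Bochner_Integration.integral_nonneg)
  show "(AE x in lborel. p x = 0) \<or> (AE x in lborel. n x = 0)" if "EL_form p n = 0"
  proof -
    have "(LINT q|(lborel \<Otimes>\<^sub>M lborel). F q) = 0"
      using that c by (simp add: EL)
    then have "AE q in lborel \<Otimes>\<^sub>M lborel. F q = 0"
      using integral_nonneg_eq_0_iff_AE[OF F_int] F_nonneg by simp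
    then have "AE q in lborel \<Otimes>\<^sub>M lborel. (case q of (x, y) \<Rightarrow> (p x)\<^sup>2 * (n y)\<^sup>2) = 0"
    proof eventually_elim
      case (elim q)
      obtain x y where q: "q = (x, y)" by (cases q)
      have "p x * n y = 0"
      proof (cases "x = y")
        case True
        then show ?thesis using disj by simp
      next
        case False
        then have "0 < k_ker (x - y) / 2 + j_ker (x - y)"
          using k_ker_plus_j_ker_pos[of "x - y"] k_ker_nonneg[of "x - y"] j_ker_nonneg[of "x - y"]
          by simp
        moreover have "p x * n y * (k_ker (x - y) / 2 + j_ker (x - y)) \<le> 0"
          using F_ge[of x y] elim q by simp
        ultimately have "p x * n y \<le> 0"
          by (simp add: mult_le_0_iff)
        moreover have "0 \<le> p x * n y"
          by (intro mult_nonneg_nonneg nonneg)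
        ultimately show ?thesis by simp
      qed
      then show ?case by (auto simp: q)
    qed
    then have "(LINT (x, y)|(lborel \<Otimes>\<^sub>M lborel). (p x)\<^sup>2 * (n y)\<^sup>2) = 0"
      by (rule integral_eq_zero_AE)
    then have "(LINT x|lborel. (p x)\<^sup>2) = 0 \<or> (LINT x|lborel. (n x)\<^sup>2) = 0"
      using p n by (simp add: integrable_tensor H_space_square_integrable)
    then show ?thesis
      using p n by (simp add: integral_nonneg_eq_0_iff_AE H_space_square_integrable)
  qed
qed

lemma pos_part_minus_neg_part: "u x = pos_part u x - neg_part u x"
  and pos_part_mult_neg_part: "pos_part u x * neg_part u x = 0"
  and pos_part_nonneg: "0 \<le> pos_part u x" and neg_part_nonneg: "0 \<le> neg_part u x"
  by (auto simp: pos_part_def neg_part_def max_def)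

lemma integral_square_pos_neg_part:
  assumes "u \<in> H_space \<Omega>"
  shows "(LINT x|lborel. (u x)\<^sup>2) =
    (LINT x|lborel. (pos_part u x)\<^sup>2) + (LINT x|lborel. (neg_part u x)\<^sup>2)"
proof -
  have "(LINT x|lborel. (u x)\<^sup>2) = (LINT x|lborel. (pos_part u x)\<^sup>2 + (neg_part u x)\<^sup>2)"
    by (rule Bochner_Integration.integral_cong) (auto simp: pos_part_def neg_part_def max_def)
  then show ?thesis
    using H_space_square_integrable[OF H_space_pos_part[OF assms]]
      H_space_square_integrable[OF H_space_neg_part[OF assms]] by simp
qed

lemma EL_form_add_add:
  assumes "open \<Omega>" "bounded \<Omega>" and u: "u \<in> H_space \<Omega>" and v: "v \<in> H_space \<Omega>"
  shows "EL_form (\<lambda>x. u x + v x) (\<lambda>x. u x + v x) = EL_form u u + 2 * EL_form u v + EL_form v v"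
proof -
  note add = EL_form_add_left[OF assms(1,2)]
  have "EL_form u (\<lambda>x. u x + v x) = EL_form u u + EL_form v u"
       "EL_form v (\<lambda>x. u x + v x) = EL_form u v + EL_form v v"
    using u v by (simp_all add: EL_form_commute[of _ \<Omega> "\<lambda>x. u x + v x"] H_space_add add)
  then show ?thesis
    using u v by (simp add: add H_space_add EL_form_commute[of v \<Omega> u])
qed

lemma EL_form_pos_neg_part:
  assumes \<Omega>: "open \<Omega>" "bounded \<Omega>" and u: "u \<in> H_space \<Omega>"
  shows "EL_form u u = EL_form (pos_part u) (pos_part u) + EL_form (neg_part u) (neg_part u)
                         - 2 * EL_form (pos_part u) (neg_part u)"
proof -
  note p = H_space_pos_part[OF u] and n = H_space_neg_part[OF u]
  have "u = (\<lambda>x. pos_part u x + - neg_part u x)"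
    using pos_part_minus_neg_part[of u] by auto
  then have "EL_form u u = EL_form (pos_part u) (pos_part u)
      + 2 * EL_form (pos_part u) (\<lambda>x. - neg_part u x)
      + EL_form (\<lambda>x. - neg_part u x) (\<lambda>x. - neg_part u x)"
    using EL_form_add_add[OF \<Omega> p H_space_uminus[OF n]] by metis
  then show ?thesis
    using p n
    by (simp add: EL_form_uminus_left EL_form_commute[of _ \<Omega> "\<lambda>x. - neg_part u x"] H_space_uminus
          EL_form_commute[of "neg_part u" \<Omega> "pos_part u"])
qed

text \<open>
  Both parts of \<open>u\<close> have Rayleigh quotient at least \<open>lambda1 \<Omega>\<close>, so equality for \<open>u\<close> leaves no room
  for a negative interaction between them.
\<close>
lemma minimizer_constant_sign:
  assumes \<Omega>: "open \<Omega>" "bounded \<Omega>" and u: "u \<in> H_space \<Omega>"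
    and min: "EL_form u u \<le> lambda1 \<Omega> * (LINT x|lborel. (u x)\<^sup>2)"
  shows "(AE x in lborel. 0 \<le> u x) \<or> (AE x in lborel. u x \<le> 0)"
proof -
  note p = H_space_pos_part[OF u] and n = H_space_neg_part[OF u]
  note disj = EL_form_disjoint_supports[OF \<Omega> p n pos_part_nonneg neg_part_nonneg
                pos_part_mult_neg_part]
  have "EL_form (pos_part u) (neg_part u) = 0"
    using min EL_form_pos_neg_part[OF \<Omega> u] lambda1_le[OF \<Omega> p] lambda1_le[OF \<Omega> n] disj(1)
    by (simp add: integral_square_pos_neg_part[OF u] algebra_simps)
  from disj(2)[OF this] show ?thesis
  proof
    assume "AE x in lborel. pos_part u x = 0"
    then have "AE x in lborel. u x \<le> 0"
      by eventually_elim (simp add: pos_part_def max_def split: if_splits)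
    then show ?thesis ..
  next
    assume "AE x in lborel. neg_part u x = 0"
    then have "AE x in lborel. 0 \<le> u x"
      by eventually_elim (simp add: neg_part_def max_def split: if_splits)
    then show ?thesis ..
  qed
qed

text \<open>
  Adding \<open>\<phi>\<close> to \<open>w\<close> does not change the excess
  \<open>EL_form w w - lambda1 \<Omega> * \<integral> w\<^sup>2\<close>, since \<open>\<phi>\<close> lies in the kernel of that form. If the
  excess vanishes then \<open>w + \<phi>\<close> is a minimizer and has constant sign, so \<open>\<phi>\<close> and \<open>-w\<close> are ordered
  nonnegative functions of equal norm, and coincide.
\<close>
lemma nonpositive_minimizer_unique:
  assumes \<Omega>: "open \<Omega>" "bounded \<Omega>" and \<phi>: "\<phi> \<in> H_space \<Omega>" and w: "w \<in> H_space \<Omega>"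
    and weak: "\<And>v. v \<in> H_space \<Omega> \<Longrightarrow> EL_form \<phi> v = lambda1 \<Omega> * (LINT x|lborel. \<phi> x * v x)"
    and sign: "AE x in lborel. 0 \<le> \<phi> x" "AE x in lborel. w x \<le> 0"
    and norm: "(LINT x|lborel. (\<phi> x)\<^sup>2) = (LINT x|lborel. (w x)\<^sup>2)"
    and min: "EL_form w w \<le> lambda1 \<Omega> * (LINT x|lborel. (w x)\<^sup>2)"
  shows "AE x in lborel. w x = - \<phi> x"
proof -
  define z where "z = (\<lambda>x. \<phi> x + w x)"
  have z: "z \<in> H_space \<Omega>"
    unfolding z_def by (rule H_space_add[OF \<phi> w])
  note sq = H_space_square_integrable[OF \<phi>] H_space_square_integrable[OF w]
  have "EL_form z z = EL_form \<phi> \<phi> + 2 * EL_form \<phi> w + EL_form w w"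
    unfolding z_def by (rule EL_form_add_add[OF \<Omega> \<phi> w])
  moreover have "(LINT x|lborel. (z x)\<^sup>2)
      = (LINT x|lborel. (\<phi> x)\<^sup>2 + 2 * (\<phi> x * w x) + (w x)\<^sup>2)"
    by (simp add: z_def power2_sum ac_simps)
  then have "(LINT x|lborel. (z x)\<^sup>2)
      = (LINT x|lborel. (\<phi> x)\<^sup>2) + 2 * (LINT x|lborel. \<phi> x * w x) + (LINT x|lborel. (w x)\<^sup>2)"
    using sq H_space_mult_integrable[OF \<phi> w] by simp
  ultimately have "EL_form z z \<le> lambda1 \<Omega> * (LINT x|lborel. (z x)\<^sup>2)"
    using min weak[OF \<phi>] weak[OF w] by (simp add: power2_eq_square algebra_simps)
  then have "(AE x in lborel. 0 \<le> z x) \<or> (AE x in lborel. z x \<le> 0)"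
    by (rule minimizer_constant_sign[OF \<Omega> z])
  then have "(AE x in lborel. (w x)\<^sup>2 \<le> (\<phi> x)\<^sup>2) \<or> (AE x in lborel. (\<phi> x)\<^sup>2 \<le> (w x)\<^sup>2)"
  proof (rule disj_forward)
    assume "AE x in lborel. 0 \<le> z x"
    with sign show "AE x in lborel. (w x)\<^sup>2 \<le> (\<phi> x)\<^sup>2"
      by eventually_elim (auto simp: z_def abs_le_square_iff[symmetric])
  next
    assume "AE x in lborel. z x \<le> 0"
    with sign show "AE x in lborel. (\<phi> x)\<^sup>2 \<le> (w x)\<^sup>2"
      by eventually_elim (auto simp: z_def abs_le_square_iff[symmetric])
  qed
  then have "AE x in lborel. (\<phi> x)\<^sup>2 = (w x)\<^sup>2"
  proof
    assume "AE x in lborel. (w x)\<^sup>2 \<le> (\<phi> x)\<^sup>2"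
    from integral_ineq_eq_0_then_AE[OF this sq(2,1) norm[symmetric]] show ?thesis
      by eventually_elim simp
  next
    assume "AE x in lborel. (\<phi> x)\<^sup>2 \<le> (w x)\<^sup>2"
    from integral_ineq_eq_0_then_AE[OF this sq norm] show ?thesis .
  qed
  with sign show ?thesis
    by eventually_elim (auto simp: power2_eq_iff)
qed

section \<open>Lower bounds for the nonlocal energy\<close>

lemma nn_integral_lborel_reflect:
  fixes f :: "'a::euclidean_space \<Rightarrow> ennreal"
  assumes [measurable]: "f \<in> borel_measurable borel"
  shows "(\<integral>\<^sup>+y. f (x - y) \<partial>lborel) = (\<integral>\<^sup>+y. f y \<partial>lborel)"
proof -
  have "(lborel :: 'a measure) = distr lborel borel (\<lambda>y. x - y)"
    using lborel_affine[of "-1" x] by (simp add: density_1)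
  then have "(\<integral>\<^sup>+y. f y \<partial>lborel) = (\<integral>\<^sup>+y. f y \<partial>distr lborel borel (\<lambda>y. x - y))"
    by simp
  then show ?thesis by (simp add: nn_integral_distr)
qed

lemma nn_integral_lborel_translate:
  fixes f :: "'a::euclidean_space \<Rightarrow> ennreal"
  assumes [measurable]: "f \<in> borel_measurable borel"
  shows "(\<integral>\<^sup>+y. f (x + y) \<partial>lborel) = (\<integral>\<^sup>+y. f y \<partial>lborel)"
proof -
  have "(\<integral>\<^sup>+y. f y \<partial>lborel) = (\<integral>\<^sup>+y. f y \<partial>distr lborel borel ((+) x))"
    by (simp add: lborel_distr_plus)
  then show ?thesis by (simp add: nn_integral_distr)
qed

lemma nn_integral_energy:
  fixes u :: "'a::euclidean_space \<Rightarrow> real"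
  assumes u: "u \<in> H_space \<Omega>"
  shows "(\<integral>\<^sup>+x. \<integral>\<^sup>+y. ennreal ((u x - u y)\<^sup>2 * k_ker (x - y)) \<partial>lborel \<partial>lborel)
    = ennreal (2 / c_const DIM('a) * E_form u u)"
proof -
  note [measurable] = H_space_measurable[OF u]
  have c: "0 < c_const DIM('a)"
    by (rule c_const_pos[OF DIM_positive])
  have "(\<integral>\<^sup>+x. \<integral>\<^sup>+y. ennreal ((u x - u y)\<^sup>2 * k_ker (x - y)) \<partial>lborel \<partial>lborel)
      = (\<integral>\<^sup>+p. ennreal (case p of (x, y) \<Rightarrow> (u x - u y)\<^sup>2 * k_ker (x - y)) \<partial>(lborel \<Otimes>\<^sub>M lborel))"
    by (subst lborel.nn_integral_fst[symmetric]) auto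
  also have "\<dots> = ennreal (LINT (x, y)|(lborel \<Otimes>\<^sub>M lborel). (u x - u y)\<^sup>2 * k_ker (x - y))"
    by (rule nn_integral_eq_integral[OF H_space_energy_integrable[OF u]]) (auto simp: k_ker_nonneg)
  finally show ?thesis
    using c by (simp add: E_form_def power2_eq_square)
qed

lemma emeasure_annulus:
  fixes r s :: real
  assumes "0 \<le> r" "r \<le> s"
  shows "emeasure lborel (ball 0 s - ball (0::'a::euclidean_space) r)
    = ennreal (unit_ball_vol DIM('a) * (s ^ DIM('a) - r ^ DIM('a)))"
proof -
  have "emeasure lborel (ball 0 s - ball (0::'a) r)
      = emeasure lborel (ball (0::'a) s) - emeasure lborel (ball (0::'a) r)"
    using assms by (intro emeasure_Diff) (auto simp: emeasure_ball)
  also have "\<dots> = ennreal (unit_ball_vol DIM('a) * s ^ DIM('a) - unit_ball_vol DIM('a) * r ^ DIM('a))"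
    using assms by (simp add: emeasure_ball ennreal_minus)
  finally show ?thesis by (simp add: right_diff_distrib)
qed

text \<open>
  The kernel is homogeneous of degree \<open>-N\<close>, so all dyadic annuli carry at least the mass that the
  constant 1 has on the largest of them, and the mass outside small balls is unbounded.
\<close>
lemma k_ker_mass_outside_ball:
  fixes n :: nat
  shows "ennreal (n * (unit_ball_vol DIM('a) * (1 - (1 / 2) ^ DIM('a))))
    \<le> (\<integral>\<^sup>+z. ennreal (k_ker z) * indicator (- ball (0::'a::euclidean_space) ((1 / 2) ^ n)) z \<partial>lborel)"
proof (induction n)
  case 0
  then show ?case by simp
next
  case (Suc n)
  let ?N = "DIM('a)"
  let ?\<kappa> = "unit_ball_vol ?N * (1 - (1 / 2) ^ ?N)"
  define r :: real where "r = (1 / 2) ^ n"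
  define A where "A = ball (0::'a) r - ball 0 (r / 2)"
  have r: "0 < r" "r \<le> 1" by (simp_all add: r_def power_le_one)
  have [measurable]: "A \<in> sets borel" by (simp add: A_def)
  have \<kappa>: "0 \<le> ?\<kappa>" by (simp add: power_le_one)
  have "ennreal ?\<kappa> = ennreal (1 / r ^ ?N) * emeasure lborel A"
    using r by (simp add: A_def emeasure_annulus ennreal_mult'[symmetric] power_divide field_simps)
  also have "\<dots> = (\<integral>\<^sup>+z. ennreal (1 / r ^ ?N) * indicator A z \<partial>lborel)"
    by (simp add: nn_integral_cmult_indicator)
  also have "\<dots> \<le> (\<integral>\<^sup>+z. ennreal (k_ker z) * indicator A z \<partial>lborel)"
  proof (rule nn_integral_mono)
    fix z :: 'a
    show "ennreal (1 / r ^ ?N) * indicator A z \<le> ennreal (k_ker z) * indicator A z"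
    proof (cases "z \<in> A")
      case True
      then have z: "norm z < r" "r / 2 \<le> norm z" by (auto simp: A_def)
      then have "norm z ^ ?N \<le> r ^ ?N" "0 < norm z"
        using r by (auto intro!: power_mono)
      then show ?thesis
        using True z r by (auto simp: k_ker_def intro!: ennreal_leI divide_left_mono)
    qed simp
  qed
  finally have step: "ennreal ?\<kappa> \<le> (\<integral>\<^sup>+z. ennreal (k_ker z) * indicator A z \<partial>lborel)" .
  have "ennreal (Suc n * ?\<kappa>) = ennreal (n * ?\<kappa>) + ennreal ?\<kappa>"
    using \<kappa> by (simp add: ennreal_plus[symmetric] distrib_right del: ennreal_plus)
  also have "\<dots> \<le> (\<integral>\<^sup>+z. ennreal (k_ker z) * indicator (- ball (0::'a) r) z \<partial>lborel)
                + (\<integral>\<^sup>+z. ennreal (k_ker z) * indicator A z \<partial>lborel)"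
    using Suc step by (intro add_mono) (simp_all add: r_def)
  also have "\<dots> = (\<integral>\<^sup>+z. ennreal (k_ker z) * indicator (- ball (0::'a) r) z
                     + ennreal (k_ker z) * indicator A z \<partial>lborel)"
    by (subst nn_integral_add) auto
  also have "\<dots> = (\<integral>\<^sup>+z. ennreal (k_ker z) * indicator (- ball (0::'a) ((1 / 2) ^ Suc n)) z \<partial>lborel)"
    using r by (intro nn_integral_cong) (auto simp: A_def r_def[symmetric] indicator_def)
  finally show ?case .
qed

text \<open>
  Removing a set \<open>A\<close> from the annulus \<open>\<eta> \<le> \<bar>z\<bar> < 1\<close> costs at most \<open>\<bar>A\<bar> / \<eta>\<^sup>N\<close> of the mass of the
  kernel, which is at most 1 for \<open>\<bar>A\<bar> \<le> \<eta>\<^sup>N\<close>.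
\<close>
lemma k_ker_mass_outside_small_set:
  fixes M :: real
  assumes "0 \<le> M"
  shows "\<exists>d>0. \<forall>A\<in>sets borel. emeasure lborel A \<le> ennreal d \<longrightarrow>
    (\<forall>x::'a::euclidean_space. ennreal M \<le> (\<integral>\<^sup>+y. ennreal (k_ker (x - y)) * indicator (- A) y \<partial>lborel))"
proof -
  let ?N = "DIM('a)"
  let ?\<kappa> = "unit_ball_vol ?N * (1 - (1 / 2) ^ ?N)"
  have "0 < ?\<kappa>"
    by (simp add: power_less_one_iff)
  then obtain n :: nat where n: "M + 1 \<le> n * ?\<kappa>"
    using reals_Archimedean3[of ?\<kappa>] by (metis less_imp_le)
  define \<eta> :: real where "\<eta> = (1 / 2) ^ n"
  have \<eta>: "0 < \<eta>" by (simp add: \<eta>_def)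
  have "ennreal M \<le> (\<integral>\<^sup>+y. ennreal (k_ker (x - y)) * indicator (- A) y \<partial>lborel)"
    if A[measurable]: "A \<in> sets borel" and small: "emeasure lborel A \<le> ennreal (\<eta> ^ ?N)"
    for A and x :: 'a
  proof -
    have "ennreal M + 1 = ennreal (M + 1)"
      using \<open>0 \<le> M\<close> by simp
    also have "\<dots> \<le> (\<integral>\<^sup>+z. ennreal (k_ker z) * indicator (- ball (0::'a) \<eta>) z \<partial>lborel)"
      using ennreal_leI[OF n] k_ker_mass_outside_ball[where 'a='a, of n]
      by (simp add: \<eta>_def)
    also have "\<dots> = (\<integral>\<^sup>+y. ennreal (k_ker (x - y)) * indicator (- ball 0 \<eta>) (x - y) \<partial>lborel)"
      by (rule nn_integral_lborel_reflect[symmetric]) simp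
    also have "\<dots> \<le> (\<integral>\<^sup>+y. ennreal (k_ker (x - y)) * indicator (- A) y
                         + ennreal (1 / \<eta> ^ ?N) * indicator A y \<partial>lborel)"
    proof (rule nn_integral_mono)
      fix y
      have "k_ker (x - y) \<le> 1 / \<eta> ^ ?N" if "\<eta> \<le> norm (x - y)"
      proof -
        have "0 < norm (x - y)" using that \<eta> by linarith
        then show ?thesis
          using that \<eta> by (auto simp: k_ker_def indicator_def intro!: divide_left_mono power_mono)
      qed
      then show "ennreal (k_ker (x - y)) * indicator (- ball 0 \<eta>) (x - y)
          \<le> ennreal (k_ker (x - y)) * indicator (- A) y + ennreal (1 / \<eta> ^ ?N) * indicator A y"
        by (auto simp: indicator_def intro!: ennreal_leI)
    qed
    also have "\<dots> = (\<integral>\<^sup>+y. ennreal (k_ker (x - y)) * indicator (- A) y \<partial>lborel)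
                  + ennreal (1 / \<eta> ^ ?N) * emeasure lborel A"
      by (subst nn_integral_add) (auto simp: nn_integral_cmult_indicator)
    also have "\<dots> \<le> (\<integral>\<^sup>+y. ennreal (k_ker (x - y)) * indicator (- A) y \<partial>lborel)
                  + ennreal (1 / \<eta> ^ ?N) * ennreal (\<eta> ^ ?N)"
      by (intro add_left_mono mult_left_mono small) auto
    also have "ennreal (1 / \<eta> ^ ?N) * ennreal (\<eta> ^ ?N) = 1"
      using \<eta> by (simp add: ennreal_mult'[symmetric])
    finally show ?thesis
      by (simp add: add.commute[of _ 1] ennreal_add_left_cancel_le)
  qed
  then show ?thesis
    using \<eta> by (intro exI[of _ "\<eta> ^ ?N"]) auto
qed

text \<open>
  A function supported on a set of small measure pays for the jump from each point of the support
  to its complement: only the pairs with \<open>y \<notin> A\<close>, where the difference is \<open>u x\<close>, are counted.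
\<close>
lemma E_form_ge_small_support:
  fixes M :: real
  assumes "0 \<le> M"
  shows "\<exists>d>0. \<forall>A\<in>sets borel. emeasure lborel A \<le> ennreal d \<longrightarrow>
    (\<forall>(u :: 'a::euclidean_space \<Rightarrow> real)\<in>H_space \<Omega>. (\<forall>x. x \<notin> A \<longrightarrow> u x = 0) \<longrightarrow>
       M * (LINT x|lborel. (u x)\<^sup>2) \<le> E_form u u)"
proof -
  have c: "0 < c_const DIM('a)"
    by (rule c_const_pos[OF DIM_positive])
  define K where "K = 2 / c_const DIM('a) * M"
  have K: "0 \<le> K" using c \<open>0 \<le> M\<close> by (simp add: K_def)
  obtain d where d: "0 < d" and mass: "\<And>A (x::'a). A \<in> sets borel \<Longrightarrow> emeasure lborel A \<le> ennreal d \<Longrightarrow>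
      ennreal K \<le> (\<integral>\<^sup>+y. ennreal (k_ker (x - y)) * indicator (- A) y \<partial>lborel)"
    using k_ker_mass_outside_small_set[OF K, where 'a='a] by blast
  have "M * (LINT x|lborel. (u x)\<^sup>2) \<le> E_form u u"
    if A[measurable]: "A \<in> sets borel" and small: "emeasure lborel A \<le> ennreal d"
      and u: "u \<in> H_space \<Omega>" and supp: "\<And>x. x \<notin> A \<Longrightarrow> u x = 0"
    for A and u :: "'a \<Rightarrow> real"
  proof -
    note [measurable] = H_space_measurable[OF u]
    have "ennreal (K * (LINT x|lborel. (u x)\<^sup>2)) = (\<integral>\<^sup>+x. ennreal ((u x)\<^sup>2) * ennreal K \<partial>lborel)"
      using K by (subst nn_integral_multc)
        (auto simp: nn_integral_eq_integral H_space_square_integrable[OF u] ennreal_mult' mult.commute)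
    also have "\<dots> \<le> (\<integral>\<^sup>+x. ennreal ((u x)\<^sup>2) *
                   (\<integral>\<^sup>+y. ennreal (k_ker (x - y)) * indicator (- A) y \<partial>lborel) \<partial>lborel)"
      by (intro nn_integral_mono mult_left_mono mass A small) auto
    also have "\<dots> = (\<integral>\<^sup>+x. \<integral>\<^sup>+y. ennreal ((u x)\<^sup>2) * (ennreal (k_ker (x - y)) * indicator (- A) y)
                   \<partial>lborel \<partial>lborel)"
      by (subst nn_integral_cmult) auto
    also have "\<dots> \<le> (\<integral>\<^sup>+x. \<integral>\<^sup>+y. ennreal ((u x - u y)\<^sup>2 * k_ker (x - y)) \<partial>lborel \<partial>lborel)"
      by (intro nn_integral_mono) (auto simp: indicator_def supp ennreal_mult' k_ker_nonneg)
    also have "\<dots> = ennreal (2 / c_const DIM('a) * E_form u u)"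
      by (rule nn_integral_energy[OF u])
    finally have "K * (LINT x|lborel. (u x)\<^sup>2) \<le> 2 / c_const DIM('a) * E_form u u"
      using c E_form_nonneg[of u] by (subst (asm) ennreal_le_iff) (auto intro: divide_nonneg_pos)
    then show ?thesis
      using c by (simp add: K_def field_simps)
  qed
  then show ?thesis
    using d by (intro exI[of _ d]) blast
qed

text \<open>
  Where \<open>u x \<noteq> 0\<close>, the value \<open>u x\<close> telescopes into the \<open>n\<close> increments along \<open>x\<close>, \<open>x + h\<close>, ...,
  \<open>x + n h\<close>. All increments have the same norm by translation invariance; one factor \<open>n\<close> is
  their number and the other comes from the Cauchy-Schwarz inequality.
\<close>
lemma square_integral_le_translation:
  fixes u :: "'a::euclidean_space \<Rightarrow> real"
  assumes [measurable]: "u \<in> borel_measurable borel"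
    and leaves: "\<And>x. u x \<noteq> 0 \<Longrightarrow> u (x + real n *\<^sub>R h) = 0"
  shows "(\<integral>\<^sup>+x. ennreal ((u x)\<^sup>2) \<partial>lborel)
    \<le> ennreal (n\<^sup>2) * (\<integral>\<^sup>+x. ennreal ((u x - u (x + h))\<^sup>2) \<partial>lborel)"
proof -
  define D where "D = (\<integral>\<^sup>+x. ennreal ((u x - u (x + h))\<^sup>2) \<partial>lborel)"
  define g where "g = (\<lambda>i x. u (x + real i *\<^sub>R h) - u (x + real (Suc i) *\<^sub>R h))"
  have [measurable]: "g i \<in> borel_measurable borel" for i
    unfolding g_def by measurable
  have pointwise: "(u x)\<^sup>2 \<le> n * (\<Sum>i<n. (g i x)\<^sup>2)" for x
  proof (cases "u x = 0")
    case True
    then show ?thesis by (simp add: sum_nonneg)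
  next
    case False
    then have "u x = (\<Sum>i<n. g i x)"
      using leaves sum_lessThan_telescope'[of "\<lambda>i. u (x + real i *\<^sub>R h)" n]
      by (simp add: g_def)
    then show ?thesis
      using sum_squared_le_sum_of_squares[of "\<lambda>i. g i x" "{..<n}"] by (simp add: mult.commute)
  qed
  have shift: "(\<integral>\<^sup>+x. ennreal ((g i x)\<^sup>2) \<partial>lborel) = D" for i
    unfolding D_def g_def
    using nn_integral_lborel_translate[of "\<lambda>x. ennreal ((u x - u (x + h))\<^sup>2)" "real i *\<^sub>R h"]
    by (simp add: algebra_simps)
  have "(\<integral>\<^sup>+x. ennreal ((u x)\<^sup>2) \<partial>lborel) \<le> (\<integral>\<^sup>+x. ennreal (n * (\<Sum>i<n. (g i x)\<^sup>2)) \<partial>lborel)"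
    by (intro nn_integral_mono ennreal_leI pointwise)
  also have "\<dots> = ennreal n * (\<Sum>i<n. \<integral>\<^sup>+x. ennreal ((g i x)\<^sup>2) \<partial>lborel)"
    by (simp add: ennreal_mult' sum_ennreal[symmetric] nn_integral_cmult nn_integral_sum
        del: sum_ennreal)
  also have "\<dots> = ennreal n * (ennreal n * D)"
    by (simp add: shift ennreal_of_nat_eq_real_of_nat)
  also have "\<dots> = ennreal (n\<^sup>2) * D"
    by (simp add: power2_eq_square ennreal_mult' mult.assoc)
  finally show ?thesis by (simp add: D_def)
qed

text \<open>
  The form \<open>E\<close> sees only pairs of points at distance less than 1, while \<open>\<Omega>\<close> may be larger. A fixed
  number \<open>n\<close> of translations by any \<open>h\<close> with \<open>1/2 \<le> \<bar>h\<bar> < 1\<close> moves \<open>\<Omega>\<close> off itself, so the norm of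
  \<open>u\<close> is controlled by that of the increments of \<open>u\<close> along \<open>h\<close>. The kernel is at least 1 on this
  annulus, and averaging over it gives the energy.
\<close>
lemma H_space_Poincare:
  fixes \<Omega> :: "'a::euclidean_space set"
  assumes "bounded \<Omega>"
  shows "\<exists>C>0. \<forall>u\<in>H_space \<Omega>. (LINT x|lborel. (u x)\<^sup>2) \<le> C * E_form u u"
proof -
  let ?N = "DIM('a)"
  have c: "0 < c_const ?N"
    by (rule c_const_pos[OF DIM_positive])
  obtain R where R: "\<And>x. x \<in> \<Omega> \<Longrightarrow> norm x \<le> R"
    using assms by (auto simp: bounded_iff)
  obtain n :: nat where n: "4 * R + 1 < real n" "0 < n"
    by (metis reals_Archimedean2 gr0I of_nat_0_less_iff max_less_iff_conj)
  define A where "A = ball (0::'a) 1 - ball 0 (1 / 2)"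
  have [measurable]: "A \<in> sets borel" by (simp add: A_def)
  define V where "V = unit_ball_vol ?N * (1 - (1 / 2) ^ ?N)"
  have V: "0 < V" "emeasure lborel A = ennreal V"
    by (simp_all add: V_def A_def emeasure_annulus power_less_one_iff)
  define C where "C = n\<^sup>2 * (2 / c_const ?N) / V"
  have "(LINT x|lborel. (u x)\<^sup>2) \<le> C * E_form u u" if u: "u \<in> H_space \<Omega>" for u
  proof -
    note [measurable] = H_space_measurable[OF u]
    define S where "S = (LINT x|lborel. (u x)\<^sup>2)"
    have leaves: "u (x + real n *\<^sub>R h) = 0" if "h \<in> A" "u x \<noteq> 0" for x h
    proof (rule ccontr)
      assume "u (x + real n *\<^sub>R h) \<noteq> 0"
      then have "norm (x + real n *\<^sub>R h) \<le> R" "norm x \<le> R"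
        using that H_space_outside[OF u] R by blast+
      then have "norm ((x + real n *\<^sub>R h) - x) \<le> 2 * R"
        using norm_triangle_ineq4[of "x + real n *\<^sub>R h" x] by linarith
      moreover have "real n * (1 / 2) \<le> real n * norm h"
        using that by (intro mult_left_mono) (auto simp: A_def)
      ultimately show False using n by simp
    qed
    have "ennreal (S * V) = ennreal S * emeasure lborel A"
      using V by (simp add: ennreal_mult'')
    also have "\<dots> = (\<integral>\<^sup>+h. (\<integral>\<^sup>+x. ennreal ((u x)\<^sup>2) \<partial>lborel) * indicator A h \<partial>lborel)"
      by (simp add: S_def nn_integral_cmult_indicator nn_integral_eq_integral
          H_space_square_integrable[OF u])
    also have "\<dots> \<le> (\<integral>\<^sup>+h. ennreal (n\<^sup>2) *
        (\<integral>\<^sup>+x. ennreal ((u x - u (x + h))\<^sup>2 * k_ker h) \<partial>lborel) \<partial>lborel)"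
    proof (rule nn_integral_mono)
      fix h :: 'a
      show "(\<integral>\<^sup>+x. ennreal ((u x)\<^sup>2) \<partial>lborel) * indicator A h
          \<le> ennreal (n\<^sup>2) * (\<integral>\<^sup>+x. ennreal ((u x - u (x + h))\<^sup>2 * k_ker h) \<partial>lborel)"
      proof (cases "h \<in> A")
        case True
        then have h: "norm h < 1" "0 < norm h" by (auto simp: A_def)
        then have "1 \<le> k_ker h"
          using power_le_one[of "norm h" ?N] by (auto simp: k_ker_def)
        then have "(u x - u (x + h))\<^sup>2 \<le> (u x - u (x + h))\<^sup>2 * k_ker h" for x
          using mult_left_mono[of 1 "k_ker h" "(u x - u (x + h))\<^sup>2"] by simp
        then have "(\<integral>\<^sup>+x. ennreal ((u x - u (x + h))\<^sup>2) \<partial>lborel)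
            \<le> (\<integral>\<^sup>+x. ennreal ((u x - u (x + h))\<^sup>2 * k_ker h) \<partial>lborel)"
          by (intro nn_integral_mono ennreal_leI)
        then have "ennreal (n\<^sup>2) * (\<integral>\<^sup>+x. ennreal ((u x - u (x + h))\<^sup>2) \<partial>lborel)
            \<le> ennreal (n\<^sup>2) * (\<integral>\<^sup>+x. ennreal ((u x - u (x + h))\<^sup>2 * k_ker h) \<partial>lborel)"
          by (rule mult_left_mono) simp
        with square_integral_le_translation[of u n h] leaves[OF True]
        show ?thesis
          using True by (auto intro: order_trans)
      qed simp
    qed
    also have "\<dots> = ennreal (n\<^sup>2) *
        (\<integral>\<^sup>+h. \<integral>\<^sup>+x. ennreal ((u x - u (x + h))\<^sup>2 * k_ker h) \<partial>lborel \<partial>lborel)"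
      by (rule nn_integral_cmult) measurable
    also have "(\<integral>\<^sup>+h. \<integral>\<^sup>+x. ennreal ((u x - u (x + h))\<^sup>2 * k_ker h) \<partial>lborel \<partial>lborel)
        = (\<integral>\<^sup>+x. \<integral>\<^sup>+h. ennreal ((u x - u (x + h))\<^sup>2 * k_ker h) \<partial>lborel \<partial>lborel)"
      by (rule lborel_pair.Fubini') measurable
    also have "\<dots> = (\<integral>\<^sup>+x. \<integral>\<^sup>+y. ennreal ((u x - u y)\<^sup>2 * k_ker (x - y)) \<partial>lborel \<partial>lborel)"
    proof (rule nn_integral_cong)
      fix x
      show "(\<integral>\<^sup>+h. ennreal ((u x - u (x + h))\<^sup>2 * k_ker h) \<partial>lborel)
          = (\<integral>\<^sup>+y. ennreal ((u x - u y)\<^sup>2 * k_ker (x - y)) \<partial>lborel)"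
        using nn_integral_lborel_translate[of "\<lambda>y. ennreal ((u x - u y)\<^sup>2 * k_ker (y - x))" x]
        by (simp add: k_ker_commute[of x])
    qed
    also have "\<dots> = ennreal (2 / c_const ?N * E_form u u)"
      by (rule nn_integral_energy[OF u])
    also have "ennreal (n\<^sup>2) * \<dots> = ennreal (n\<^sup>2 * (2 / c_const ?N * E_form u u))"
      by (rule ennreal_mult'[symmetric]) simp
    finally have "S * V \<le> n\<^sup>2 * (2 / c_const ?N * E_form u u)"
      using c E_form_nonneg[of u] by (subst (asm) ennreal_le_iff) (auto intro: divide_nonneg_pos)
    then show ?thesis
      using V c by (simp add: C_def S_def field_simps)
  qed
  moreover have "0 < C"
    using V c n by (simp add: C_def)
  ultimately show ?thesis by blast
qed

text \<open>
  Where \<open>w > 0\<close>, either \<open>\<phi>\<close> is small, which happens on a small set because \<open>\<phi> > 0\<close> almost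
  everywhere and \<open>\<Omega>\<close> has finite measure, or \<open>w + \<phi>\<close> is bounded below, which Markov's inequality
  excludes outside a small set.
\<close>
lemma small_positivity_set:
  fixes \<phi> :: "'a::euclidean_space \<Rightarrow> real" and d :: real
  assumes \<Omega>: "open \<Omega>" "bounded \<Omega>" and \<phi>[measurable]: "\<phi> \<in> borel_measurable borel"
    and pos: "AE x in lborel. x \<in> \<Omega> \<longrightarrow> 0 < \<phi> x" and "0 < d"
  shows "\<exists>e>0. \<forall>w\<in>H_space \<Omega>.
    integrable lborel (\<lambda>x. (w x + \<phi> x)\<^sup>2) \<and> (LINT x|lborel. (w x + \<phi> x)\<^sup>2) < e \<longrightarrow>
      emeasure lborel {x. 0 < w x} \<le> ennreal d"
proof -
  have [measurable]: "\<Omega> \<in> sets borel" using \<Omega> by simp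
  define A where "A = (\<lambda>i::nat. {x\<in>\<Omega>. \<phi> x < 1 / Suc i})"
  have A_sets[measurable]: "A i \<in> sets borel" for i
    unfolding A_def by measurable
  have fin: "emeasure lborel (A i) \<noteq> \<infinity>" for i
    using emeasure_mono[of "A i" \<Omega> lborel] emeasure_bounded_finite[OF \<Omega>(2)]
    by (auto simp: A_def top_unique)
  have "(\<lambda>i. emeasure lborel (A i)) \<longlonglongrightarrow> emeasure lborel (\<Inter>i. A i)"
  proof (rule Lim_emeasure_decseq)
    show "decseq A"
      by (intro decseq_SucI) (auto simp: A_def elim!: less_trans intro!: divide_strict_left_mono)
  qed (use fin in auto)
  moreover have "emeasure lborel (\<Inter>i. A i) = 0"
  proof -
    have "AE x in lborel. x \<notin> (\<Inter>i. A i)"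
      using pos
    proof eventually_elim
      case (elim x)
      show ?case
      proof
        assume x: "x \<in> (\<Inter>i. A i)"
        then have "0 < \<phi> x" using elim by (auto simp: A_def)
        then obtain i where "1 / real (Suc i) < \<phi> x"
          using nat_approx_posE by blast
        then show False using x by (auto simp: A_def dest!: spec[of _ i])
      qed
    qed
    then show ?thesis
      using AE_iff_measurable[of "\<Inter>i. A i" lborel "\<lambda>x. x \<notin> (\<Inter>i. A i)"] by auto
  qed
  ultimately have "(\<lambda>i. emeasure lborel (A i)) \<longlonglongrightarrow> 0" by simp
  then have "eventually (\<lambda>i. emeasure lborel (A i) < ennreal (d / 2)) sequentially"
    using \<open>0 < d\<close> by (intro order_tendstoD) auto
  then obtain i where i: "emeasure lborel (A i) < ennreal (d / 2)"
    by (auto simp: eventually_sequentially)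
  define s where "s = 1 / real (Suc i)"
  have s: "0 < s" by (simp add: s_def)
  have "emeasure lborel {x. 0 < w x} \<le> ennreal d"
    if w: "w \<in> H_space \<Omega>" and int: "integrable lborel (\<lambda>x. (w x + \<phi> x)\<^sup>2)"
      and close: "(LINT x|lborel. (w x + \<phi> x)\<^sup>2) < s\<^sup>2 * (d / 2)" for w
  proof -
    note [measurable] = H_space_measurable[OF w]
    define B where "B = {x \<in> space lborel. s\<^sup>2 \<le> (w x + \<phi> x)\<^sup>2}"
    have [measurable]: "B \<in> sets borel" unfolding B_def by measurable
    have "emeasure lborel B \<le> ennreal (1 / s\<^sup>2 * (LINT x|lborel. (w x + \<phi> x)\<^sup>2))"
      unfolding B_def using integral_Markov_inequality[OF int, of "s\<^sup>2"] s by simp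
    also have "\<dots> \<le> ennreal (d / 2)"
      using close s by (intro ennreal_leI) (simp add: field_simps)
    finally have B: "emeasure lborel B \<le> ennreal (d / 2)" .
    have "{x. 0 < w x} \<subseteq> A i \<union> B"
    proof
      fix x assume "x \<in> {x. 0 < w x}"
      then have x: "0 < w x" by simp
      then have "x \<in> \<Omega>" using H_space_outside[OF w] by force
      show "x \<in> A i \<union> B"
      proof (cases "\<phi> x < s")
        case True
        then show ?thesis using \<open>x \<in> \<Omega>\<close> by (simp add: A_def s_def)
      next
        case False
        then show ?thesis using x s by (simp add: B_def abs_le_square_iff[symmetric])
      qed
    qed
    then have "emeasure lborel {x. 0 < w x} \<le> emeasure lborel (A i \<union> B)"
      by (rule emeasure_mono) simp
    also have "\<dots> \<le> emeasure lborel (A i) + emeasure lborel B"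
      by (rule emeasure_subadditive) auto
    also have "\<dots> \<le> ennreal (d / 2) + ennreal (d / 2)"
      using i B by (intro add_mono) auto
    also have "\<dots> = ennreal d"
      using \<open>0 < d\<close> by (simp add: ennreal_plus[symmetric] del: ennreal_plus)
    finally show ?thesis .
  qed
  then show ?thesis
    using s \<open>0 < d\<close> by (intro exI[of _ "s\<^sup>2 * (d / 2)"]) auto
qed

section \<open>The negative first eigenfunction as a strict local minimum\<close>

lemma I_fun_eq: "u \<in> H_space \<Omega> \<Longrightarrow> I_fun \<Omega> u = (LINT x|lborel. (u x)\<^sup>2)"
  by (simp add: I_fun_def H_space_set_integral_square)

lemma E_r_eq: "u \<in> H_space \<Omega> \<Longrightarrow> E_r \<Omega> r u = EL_form u u - r * (LINT x|lborel. (pos_part u x)\<^sup>2)"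
  by (simp add: E_r_def H_space_set_integral_square H_space_pos_part)

context
  fixes \<Omega> :: "'a::euclidean_space set" and \<phi> :: "'a \<Rightarrow> real"
  assumes open_domain: "open \<Omega>" and bounded_domain: "bounded \<Omega>"
    and first: "first_eigenfunction \<Omega> \<phi>"
begin

lemma first_eigenfunction_H_space: "\<phi> \<in> H_space \<Omega>"
  using first by (simp add: first_eigenfunction_def)

lemma first_eigenfunction_weak:
  "v \<in> H_space \<Omega> \<Longrightarrow> EL_form \<phi> v = lambda1 \<Omega> * (LINT x|lborel. \<phi> x * v x)"
  using first by (simp add: first_eigenfunction_def set_integral_eq_integral H_space_outside)

lemma first_eigenfunction_norm: "(LINT x|lborel. (\<phi> x)\<^sup>2) = 1"
  using first
  by (simp add: first_eigenfunction_def L2_norm_on_def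
      H_space_set_integral_square[OF first_eigenfunction_H_space])

lemma first_eigenfunction_nonneg: "AE x in lborel. 0 \<le> \<phi> x"
proof -
  have "AE x in lborel. x \<in> \<Omega> \<longrightarrow> 0 < \<phi> x"
    using first by (simp add: first_eigenfunction_def)
  then show ?thesis
    by eventually_elim (use H_space_outside[OF first_eigenfunction_H_space] in force)
qed

lemma neg_eigenfunction_P_manifold: "(\<lambda>x. - \<phi> x) \<in> P_manifold \<Omega>"
  by (simp add: P_manifold_def H_space_uminus first_eigenfunction_H_space I_fun_eq first_eigenfunction_norm)

lemma pos_part_neg_eigenfunction: "AE x in lborel. pos_part (\<lambda>x. - \<phi> x) x = 0"
  using first_eigenfunction_nonneg by eventually_elim (simp add: pos_part_def)

lemma neg_eigenfunction_weak:
  "v \<in> H_space \<Omega> \<Longrightarrow> EL_form (\<lambda>x. - \<phi> x) v = lambda1 \<Omega> * (LINT x|lborel. - \<phi> x * v x)"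
  by (simp add: EL_form_uminus_left first_eigenfunction_weak)

lemma E_r_neg_eigenfunction: "E_r \<Omega> r (\<lambda>x. - \<phi> x) = lambda1 \<Omega>"
proof -
  note \<phi> = first_eigenfunction_H_space
  have "(LINT x|lborel. (pos_part (\<lambda>x. - \<phi> x) x)\<^sup>2) = 0"
    using pos_part_neg_eigenfunction by (intro integral_eq_zero_AE) auto
  moreover have "EL_form (\<lambda>x. - \<phi> x) (\<lambda>x. - \<phi> x) = lambda1 \<Omega>"
    using first_eigenfunction_norm
    by (simp add: neg_eigenfunction_weak H_space_uminus[OF \<phi>] power2_eq_square)
  ultimately show ?thesis
    by (simp add: E_r_eq H_space_uminus[OF \<phi>])
qed

lemma critical_point_neg_eigenfunction: "critical_point \<Omega> r (\<lambda>x. - \<phi> x)"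
  unfolding critical_point_def
proof (intro conjI neg_eigenfunction_P_manifold exI[of _ "lambda1 \<Omega>"] ballI)
  fix v assume v: "v \<in> H_space \<Omega>"
  have "(LINT x:\<Omega>|lborel. pos_part (\<lambda>x. - \<phi> x) x * v x) = 0"
    unfolding set_lebesgue_integral_def
    using pos_part_neg_eigenfunction by (intro integral_eq_zero_AE) auto
  then show "EL_form (\<lambda>x. - \<phi> x) v - r * (LINT x:\<Omega>|lborel. pos_part (\<lambda>x. - \<phi> x) x * v x)
      = lambda1 \<Omega> * (LINT x:\<Omega>|lborel. - \<phi> x * v x)"
    using neg_eigenfunction_weak[OF v] H_space_outside[OF v] by (simp add: set_integral_eq_integral)
qed

lemma Fucik_spectrum_neg_eigenfunction: "(lambda1 \<Omega> + r, lambda1 \<Omega>) \<in> Fucik_spectrum \<Omega>"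
proof -
  note \<phi> = first_eigenfunction_H_space
  have nontrivial: "\<not> (AE x in lborel. - \<phi> x = 0)"
  proof
    assume "AE x in lborel. - \<phi> x = 0"
    then have "(LINT x|lborel. (\<phi> x)\<^sup>2) = 0"
      by (intro integral_eq_zero_AE) auto
    then show False using first_eigenfunction_norm by simp
  qed
  have "EL_form (\<lambda>x. - \<phi> x) v = (LINT x:\<Omega>|lborel.
      ((lambda1 \<Omega> + r) * pos_part (\<lambda>x. - \<phi> x) x - lambda1 \<Omega> * neg_part (\<lambda>x. - \<phi> x) x) * v x)"
    if v: "v \<in> H_space \<Omega>" for v
  proof -
    note [measurable] = H_space_measurable[OF v] H_space_measurable[OF \<phi>]
    have "(LINT x:\<Omega>|lborel.
        ((lambda1 \<Omega> + r) * pos_part (\<lambda>x. - \<phi> x) x - lambda1 \<Omega> * neg_part (\<lambda>x. - \<phi> x) x) * v x)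
      = (LINT x|lborel.
        ((lambda1 \<Omega> + r) * pos_part (\<lambda>x. - \<phi> x) x - lambda1 \<Omega> * neg_part (\<lambda>x. - \<phi> x) x) * v x)"
      by (rule set_integral_eq_integral) (simp add: H_space_outside[OF v])
    also have "\<dots> = (LINT x|lborel. lambda1 \<Omega> * (- \<phi> x * v x))"
    proof (rule integral_cong_AE)
      show "AE x in lborel.
        ((lambda1 \<Omega> + r) * pos_part (\<lambda>x. - \<phi> x) x - lambda1 \<Omega> * neg_part (\<lambda>x. - \<phi> x) x) * v x
          = lambda1 \<Omega> * (- \<phi> x * v x)"
        using first_eigenfunction_nonneg
        by eventually_elim (simp add: pos_part_def neg_part_def)
    qed (unfold pos_part_def neg_part_def, measurable)
    finally show ?thesis
      using neg_eigenfunction_weak[OF v] by simp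
  qed
  then show ?thesis
    using H_space_uminus[OF \<phi>] nontrivial
    by (auto simp: Fucik_spectrum_def intro!: bexI[of _ "\<lambda>x. - \<phi> x"])
qed

text \<open>
  Near \<open>-\<phi>\<close> the set \<open>{w > 0}\<close> is small, so that the Rayleigh quotient of the positive part exceeds
  \<open>lambda1 \<Omega> + r\<close>; the value of \<open>M\<close> absorbs the lower order terms of \<open>EL_form\<close> and leaves a surplus
  of 1.
\<close>
lemma strict_local_min_neg_eigenfunction: "strict_local_min \<Omega> r (\<lambda>x. - \<phi> x)"
proof -
  note \<phi> = first_eigenfunction_H_space and \<Omega> = open_domain bounded_domain
  define \<mu> where "\<mu> = lambda1 \<Omega>"
  define K where "K = rho_const DIM('a) - 2 * c_const DIM('a) * measure lborel \<Omega>"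
  define M where "M = max 0 (\<mu> + r + 1 - K)"
  obtain d where d: "0 < d" and energy: "\<And>A (u :: 'a \<Rightarrow> real). A \<in> sets borel \<Longrightarrow>
      emeasure lborel A \<le> ennreal d \<Longrightarrow> u \<in> H_space \<Omega> \<Longrightarrow> (\<And>x. x \<notin> A \<Longrightarrow> u x = 0) \<Longrightarrow>
      M * (LINT x|lborel. (u x)\<^sup>2) \<le> E_form u u"
    using E_form_ge_small_support[of M \<Omega>] by (auto simp: M_def)
  have "AE x in lborel. x \<in> \<Omega> \<longrightarrow> 0 < \<phi> x"
    using first by (simp add: first_eigenfunction_def)
  from small_positivity_set[OF \<Omega> H_space_measurable[OF \<phi>] this d]
  obtain e where e: "0 < e" and small: "\<And>w. w \<in> H_space \<Omega> \<Longrightarrow>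
      integrable lborel (\<lambda>x. (w x + \<phi> x)\<^sup>2) \<Longrightarrow> (LINT x|lborel. (w x + \<phi> x)\<^sup>2) < e \<Longrightarrow>
      emeasure lborel {x. 0 < w x} \<le> ennreal d"
    by blast
  obtain C where C: "0 < C"
    and Poincare: "\<And>u. u \<in> H_space \<Omega> \<Longrightarrow> (LINT x|lborel. (u x)\<^sup>2) \<le> C * E_form u u"
    using H_space_Poincare[OF bounded_domain] by blast
  have "\<mu> < E_r \<Omega> r w"
    if w_P: "w \<in> P_manifold \<Omega>" and close: "H_norm (\<lambda>x. w x - - \<phi> x) < sqrt (e / C)"
      and distinct: "\<not> (AE x in lborel. w x = - \<phi> x)" for w
  proof -
    have w: "w \<in> H_space \<Omega>" and w_norm: "(LINT x|lborel. (w x)\<^sup>2) = 1"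
      using w_P by (auto simp: P_manifold_def I_fun_eq)
    note [measurable] = H_space_measurable[OF w]
    note p = H_space_pos_part[OF w] and n = H_space_neg_part[OF w]
    define P where "P = (LINT x|lborel. (pos_part w x)\<^sup>2)"
    define N where "N = (LINT x|lborel. (neg_part w x)\<^sup>2)"
    have PN: "P + N = 1" "0 \<le> P"
      using integral_square_pos_neg_part[OF w] w_norm by (simp_all add: P_def N_def)
    have E_r: "E_r \<Omega> r w = EL_form w w - r * P"
      by (simp add: E_r_eq[OF w] P_def)
    show ?thesis
    proof (cases "P = 0")
      case True
      then have "AE x in lborel. pos_part w x = 0"
        unfolding P_def
        using integral_nonneg_eq_0_iff_AE[OF H_space_square_integrable[OF p]] by simp
      then have "AE x in lborel. w x \<le> 0"
        by eventually_elim (simp add: pos_part_def max_def split: if_splits)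
      then have "\<not> EL_form w w \<le> \<mu>"
        using nonpositive_minimizer_unique[OF \<Omega> \<phi> w first_eigenfunction_weak
            first_eigenfunction_nonneg] first_eigenfunction_norm w_norm distinct
        by (auto simp: \<mu>_def)
      then show ?thesis
        using True by (simp add: E_r)
    next
      case False
      have z: "(\<lambda>x. w x + \<phi> x) \<in> H_space \<Omega>"
        by (rule H_space_add[OF w \<phi>])
      have "E_form (\<lambda>x. w x + \<phi> x) (\<lambda>x. w x + \<phi> x) < e / C"
        using close by (simp add: H_norm_def)
      then have "(LINT x|lborel. (w x + \<phi> x)\<^sup>2) < e"
        using Poincare[OF z] C by (simp add: field_simps)
      then have "emeasure lborel {x. 0 < w x} \<le> ennreal d"
        by (intro small w H_space_square_integrable[OF z])
      then have "M * P \<le> E_form (pos_part w) (pos_part w)"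
        unfolding P_def by (intro energy[of "{x. 0 < w x}"] p) (auto simp: pos_part_def)
      then have "(M + K) * P \<le> EL_form (pos_part w) (pos_part w)"
        using EL_form_ge[OF \<Omega> p] by (simp add: K_def P_def distrib_right)
      moreover have "(\<mu> + r + 1) * P \<le> (M + K) * P"
        using PN by (intro mult_right_mono) (auto simp: M_def)
      moreover have "\<mu> * N \<le> EL_form (neg_part w) (neg_part w)"
        using lambda1_le[OF \<Omega> n] by (simp add: \<mu>_def N_def)
      moreover have "EL_form (pos_part w) (neg_part w) \<le> 0"
        by (intro EL_form_disjoint_supports(1)[OF \<Omega> p n] pos_part_nonneg neg_part_nonneg
              pos_part_mult_neg_part)
      ultimately have "\<mu> * (P + N) + r * P + P \<le> EL_form w w"
        using EL_form_pos_neg_part[OF \<Omega> w] by (simp add: algebra_simps)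
      then show ?thesis
        using PN False by (simp add: E_r)
    qed
  qed
  moreover have "0 < sqrt (e / C)"
    using e C by simp
  ultimately show ?thesis
    unfolding strict_local_min_def E_r_neg_eigenfunction \<mu>_def
    using neg_eigenfunction_P_manifold by blast
qed

end

theorem proposition3p5:
  fixes \<Omega> :: "'a::euclidean_space set"
    and \<phi> :: "'a \<Rightarrow> real"
    and r :: real
  assumes "C11_bounded_domain \<Omega>"
    and "first_eigenfunction \<Omega> \<phi>"
    and "r \<ge> 0"
  shows "critical_point \<Omega> r (\<lambda>x. - \<phi> x) \<and>
         strict_local_min \<Omega> r (\<lambda>x. - \<phi> x) \<and>
         E_r \<Omega> r (\<lambda>x. - \<phi> x) = lambda1 \<Omega> \<and>
         (lambda1 \<Omega> + r, lambda1 \<Omega>) \<in> Fucik_spectrum \<Omega> \<and>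
         (lambda1 \<Omega> + r, lambda1 \<Omega>) \<in> {(\<alpha>, \<beta>). \<beta> = lambda1 \<Omega>}"
proof -
  have \<Omega>: "open \<Omega>" "bounded \<Omega>"
    using assms(1) by (auto simp: C11_bounded_domain_def)
  show ?thesis
    using critical_point_neg_eigenfunction[OF \<Omega> assms(2)]
      strict_local_min_neg_eigenfunction[OF \<Omega> assms(2)]
      E_r_neg_eigenfunction[OF \<Omega> assms(2)] Fucik_spectrum_neg_eigenfunction[OF \<Omega> assms(2)]
    by simp
qed

end
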